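(* Let $\mu=\sum_{\nu\in\mathbb{N}^\infty_0}a_\nu e^{i\nu\cdot\theta}$ be a formal Fourier series with spectrum supported on $\mathbb{N}^\infty_0$ (with complex coefficients $a_\nu$), and let $C<\infty$. Assume that for every $m\ge1$ one has $A_m\mu\in H^1(\mathbb{T}^m)$ with $\|A_m\mu\|_{H^1(\mathbb{T}^m)}\le C$. Then $\mu=f$ for some $f\in H^1(\mathbb{T}^\infty)$ (that is, $\widehat f(\nu)=a_\nu$ for all $\nu\in\mathbb{N}^\infty_0$) with $\|f\|_{H^1(\mathbb{T}^\infty)}\le C$.
   Context: $\mathbb{T}$ is the unit circle and $\mathbb{T}^\infty=\{(z_1,z_2,\ldots):z_n\in\mathbb{T}\}$ is the compact abelian group (product topology) with normalized Haar measure $d\theta=d\theta_1\times d\theta_2\times\cdots$; $\mathbb{T}^m$ carries its normalized Haar measure. $\mathbb{Z}^\infty_0$ is the set of integer sequences $\nu$ with only finitely many non-zero entries, and $\mathbb{N}^\infty_0$ is the subset of those with all entries $\ge0$. $H^1(\mathbb{T}^\infty)$ is the space of $f\in L^1(\mathbb{T}^\infty)$ with Fourier coefficients $\widehat f(\nu)=\int f e^{-i\nu\cdot\theta}d\theta$ vanishing for $\nu\notin\mathbb{N}^\infty_0$, normed by the $L^1$ norm; $H^1(\mathbb{T}^m)$ is defined analogously as the space of functions in $L^1(\mathbb{T}^m)$ whose Fourier coefficients vanish at every $\eta\in\mathbb{Z}^m$ having some negative entry. The "$m$te Abschnitt" $A_m\mu$ is the formal Fourier series in the variables $\theta_1,\ldots,\theta_m$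 obtained by keeping only the indices supported on the first $m$ coordinates: $A_m\mu\sim\sum_{\eta\in\mathbb{Z}^m}a_{\widetilde\eta}\,e^{i\widetilde\eta\cdot\theta}$, where $\widetilde\eta=(\eta_1,\ldots,\eta_m,0,0,\ldots)$ (with $a_\nu=0$ for $\nu\notin\mathbb{N}^\infty_0$). "$A_m\mu\in H^1(\mathbb{T}^m)$" means this is the Fourier series of a function in $H^1(\mathbb{T}^m)$, with which $A_m\mu$ is identified. *)

theory Defs
  imports "HOL-Probability.Probability"
begin

text \<open>Normalized Haar measure on the unit circle \<open>\<T>\<close>, i.e. the push-forward of
  \<open>d\<theta> / (2 \<pi>)\<close> on \<open>[0, 2 \<pi>)\<close> under \<open>\<theta> \<mapsto> e\<^sup>i\<^sup>\<theta>\<close>.\<close>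

definition circle_haar :: "complex measure" where
  "circle_haar =
     distr (uniform_measure lborel {0..<2 * pi}) (restrict_space borel (sphere 0 1)) cis"

lemma space_circle_haar: "space circle_haar = sphere 0 1"
  by (simp add: circle_haar_def space_restrict_space)

lemma prob_space_circle_haar: "prob_space circle_haar"
proof -
  have "prob_space (uniform_measure lborel {0..<2 * pi})"
    by (rule prob_space_uniform_measure) auto
  moreover have "cis \<in> uniform_measure lborel {0..<2 * pi} \<rightarrow>\<^sub>M restrict_space borel (sphere 0 1)"
    by (rule measurable_restrict_space2)
       (auto intro!: borel_measurable_continuous_onI continuous_intros
             simp: measurable_cong_sets[OF sets_uniform_measure refl])
  ultimately show ?thesis
    unfolding circle_haar_def by (rule prob_space.prob_space_distr)
qed

text \<open>\<open>torus I\<close> is \<open>\<T>\<^sup>I\<close> with its normalized Haar measure. Coordinates are numbered from \<open>0\<close>: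
  \<open>\<T>\<^sup>m\<close> is \<open>torus {..<m}\<close> and \<open>\<T>\<^sup>\<infinity>\<close> is \<open>torus UNIV\<close>. The product \<open>\<sigma>\<close>-algebra
  is the Borel \<open>\<sigma>\<close>-algebra of the product topology, as \<open>I\<close> is countable.\<close>

definition torus :: "nat set \<Rightarrow> (nat \<Rightarrow> complex) measure" where
  "torus I = PiM I (\<lambda>_. circle_haar)"

text \<open>Frequencies on \<open>\<T>\<^sup>I\<close>, as integer sequences that vanish outside \<open>I\<close>. In particular an
  element \<open>\<eta>\<close> of \<open>\<int>\<^sup>m\<close> is represented by its extension by zero
  \<open>(\<eta>\<^sub>1, \<dots>, \<eta>\<^sub>m, 0, 0, \<dots>)\<close>.\<close>

definition freqs :: "nat set \<Rightarrow> (nat \<Rightarrow> int) set" where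
  "freqs I = {\<nu>. finite {n. \<nu> n \<noteq> 0} \<and> {n. \<nu> n \<noteq> 0} \<subseteq> I}"

definition nonneg_freqs :: "nat set \<Rightarrow> (nat \<Rightarrow> int) set" where
  "nonneg_freqs I = {\<nu> \<in> freqs I. \<forall>n. \<nu> n \<ge> 0}"

text \<open>The character \<open>e\<^sup>i\<^sup>\<nu>\<^sup>\<cdot>\<^sup>\<theta>\<close> at the point \<open>z = (e\<^sup>i\<^sup>\<theta>\<^sup>n)\<^sub>n\<close>.\<close>

definition monomial :: "(nat \<Rightarrow> int) \<Rightarrow> (nat \<Rightarrow> complex) \<Rightarrow> complex" where
  "monomial \<nu> z = (\<Prod>n | \<nu> n \<noteq> 0. z n powi \<nu> n)"

definition fourier_coeff ::
    "nat set \<Rightarrow> ((nat \<Rightarrow> complex) \<Rightarrow> complex) \<Rightarrow> (nat \<Rightarrow> int) \<Rightarrow> complex" where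
  "fourier_coeff I f \<nu> = (\<integral>z. f z * cnj (monomial \<nu> z) \<partial>torus I)"

text \<open>Functions are not identified when they agree almost everywhere.\<close>

definition H1 :: "nat set \<Rightarrow> ((nat \<Rightarrow> complex) \<Rightarrow> complex) set" where
  "H1 I = {f. integrable (torus I) f \<and>
              (\<forall>\<nu> \<in> freqs I - nonneg_freqs I. fourier_coeff I f \<nu> = 0)}"

definition H1_norm :: "nat set \<Rightarrow> ((nat \<Rightarrow> complex) \<Rightarrow> complex) \<Rightarrow> real" where
  "H1_norm I f = (\<integral>z. norm (f z) \<partial>torus I)"

text \<open>A formal Fourier series on \<open>\<T>\<^sup>I\<close> is given by its coefficients \<open>a \<nu>\<close> for \<open>\<nu> \<in> freqs I\<close>;
  the values of \<open>a\<close> elsewhere are irrelevant.\<close>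

definition is_fourier_series_of ::
    "nat set \<Rightarrow> ((nat \<Rightarrow> int) \<Rightarrow> complex) \<Rightarrow> ((nat \<Rightarrow> complex) \<Rightarrow> complex) \<Rightarrow> bool" where
  "is_fourier_series_of I a f \<longleftrightarrow> (\<forall>\<nu> \<in> freqs I. fourier_coeff I f \<nu> = a \<nu>)"

definition abschnitt :: "nat \<Rightarrow> ((nat \<Rightarrow> int) \<Rightarrow> complex) \<Rightarrow> (nat \<Rightarrow> int) \<Rightarrow> complex" where
  "abschnitt m a \<nu> = (if \<nu> \<in> freqs {..<m} then a \<nu> else 0)"

end

theory Submission
  imports Defs "HOL-Complex_Analysis.Complex_Analysis"
    "HOL-Computational_Algebra.Fundamental_Theorem_Algebra"
begin

text \<open>Let \<open>g\<^sub>m\<close> be the function on \<open>\<T>\<^sup>m\<close> whose Fourier series is \<open>A\<^sub>m\<mu>\<close>. Averaging \<open>g\<^sub>m\<^sub>+\<^sub>1\<close> over the last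
coordinate deletes the frequencies that involve it, so that the \<open>g\<^sub>m\<close>, regarded as functions on
\<open>\<T>\<^sup>\<infinity>\<close>, form a martingale bounded in \<open>L\<^sup>1\<close>. Such a martingale need not converge in \<open>L\<^sup>1\<close>
(it may be the sequence of averages of a singular measure); analyticity is what excludes this.

Almost every slice \<open>w \<mapsto> g\<^sub>m\<^sub>+\<^sub>1(z, w)\<close> is a one-variable \<open>H\<^sup>1\<close> function with mean \<open>g\<^sub>m(z)\<close>, and for such
functions not only the modulus but also its square root has the sub-mean value property
(\<open>sqrt_submean_poly\<close>, \<open>sqrt_submean_slice\<close>). Hence \<open>h\<^sub>m = \<bar>g\<^sub>m\<bar>\<^sup>1\<^sup>/\<^sup>2\<close> is a submartingale bounded in the
Hilbert space \<open>L\<^sup>2\<close>. For \<open>m \<le> n\<close> it satisfies \<open>\<integral> h\<^sub>n h\<^sub>m \<ge> \<integral> h\<^sub>m\<^sup>2\<close>, so that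
\<open>\<integral> (h\<^sub>n - h\<^sub>m)\<^sup>2 \<le> \<integral> h\<^sub>n\<^sup>2 - \<integral> h\<^sub>m\<^sup>2 = \<integral> \<bar>g\<^sub>n\<bar> - \<integral> \<bar>g\<^sub>m\<bar>\<close>,
and the right hand side \<open>\<delta>\<close> tends to \<open>0\<close> because the norms \<open>\<integral> \<bar>g\<^sub>m\<bar>\<close> increase and are bounded by \<open>C\<close>. The phases are
recovered in the same way: with \<open>u\<^sub>m = g\<^sub>m / h\<^sub>m\<close>, which has modulus \<open>h\<^sub>m\<close>, the martingale
identity \<open>\<integral> g\<^sub>n cnj (sgn g\<^sub>m) = \<integral> \<bar>g\<^sub>m\<bar>\<close> bounds the real part of \<open>\<integral> u\<^sub>n cnj u\<^sub>m\<close> from below, so that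
\<open>u\<^sub>n\<close> and \<open>u\<^sub>m\<close> are close in \<open>L\<^sup>2\<close> as well. Therefore \<open>g\<^sub>m = u\<^sub>m h\<^sub>m\<close> is a Cauchy sequence in \<open>L\<^sup>1\<close>
(\<open>L1_distance_via_square_roots\<close>, \<open>cylinder_L1_limit\<close>). Fourier coefficients and norms pass to the \<open>L\<^sup>1\<close> limit.

Two classical facts support this. First, Fejer means converge in \<open>L\<^sup>1(\<T>\<^sup>m)\<close> (\<open>fejer_tendsto\<close>); they
give uniqueness of Fourier coefficients, which identifies the average of \<open>g\<^sub>m\<^sub>+\<^sub>1\<close> with \<open>g\<^sub>m\<close>, and they
approximate \<open>H\<^sup>1\<close> functions by polynomials, to which the one-variable inequality applies. Second,
the inequality for a polynomial \<open>p\<close> holds because replacing each root in the open disc by its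
reflection in the circle changes \<open>\<bar>p\<bar>\<close> nowhere on the circle, does not decrease \<open>\<bar>p(0)\<bar>\<close>, and leaves
a function that has an analytic square root (\<open>outer_square_root\<close>).\<close>

section \<open>Analytic functions on the closed disc\<close>

lemma sets_circle_haar: "sets circle_haar = sets (restrict_space borel (sphere 0 1))"
  by (simp add: circle_haar_def)

interpretation circle: prob_space circle_haar
  by (rule prob_space_circle_haar)

lemma borel_measurable_circle_haar:
  fixes f :: "complex \<Rightarrow> 'b::topological_space"
  assumes "continuous_on (sphere 0 1) f"
  shows "f \<in> borel_measurable circle_haar"
  using borel_measurable_continuous_on_restrict[OF assms]
  by (simp add: measurable_cong_sets[OF sets_circle_haar refl])

lemma integrable_circle_haar:
  fixes f :: "complex \<Rightarrow> 'b::{banach, second_countable_topology}"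
  assumes "continuous_on (sphere 0 1) f"
  shows "integrable circle_haar f"
proof -
  have "compact (f ` sphere 0 1)"
    using assms by (intro compact_continuous_image) auto
  then obtain B where B: "\<And>z. z \<in> sphere 0 1 \<Longrightarrow> norm (f z) \<le> B"
    by (meson compact_imp_bounded bounded_iff imageI)
  show ?thesis
    using B by (intro circle.integrable_const_bound[of _ B] AE_I2 borel_measurable_circle_haar assms)
      (auto simp: space_circle_haar)
qed

lemma integral_uniform_interval:
  fixes f :: "real \<Rightarrow> complex" and T :: real
  assumes cont: "continuous_on UNIV f" and T: "0 < T"
  shows "(\<integral>x. f x \<partial>uniform_measure lborel {0..<T}) = (1 / T) *\<^sub>R integral {0..T} f"
proof -
  have m[measurable]: "f \<in> borel_measurable borel"
    by (rule borel_measurable_continuous_onI[OF cont])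
  have dens: "uniform_measure lborel {0..<T} = density lborel (\<lambda>x. ennreal (indicator {0..<T} x / T))"
    unfolding uniform_measure_def
  proof (intro density_cong AE_I2)
    fix x :: real
    have "ennreal (1 / T) = 1 / ennreal T"
      using divide_ennreal[of 1 T] T by simp
    then show "indicator {0..<T} x / emeasure lborel {0..<T} = ennreal (indicator {0..<T} x / T)"
      using T by (cases "x \<in> {0..<T}") auto
  qed auto
  have "(\<integral>x. f x \<partial>uniform_measure lborel {0..<T}) = (\<integral>x. (indicator {0..<T} x / T) *\<^sub>R f x \<partial>lborel)"
    unfolding dens by (rule integral_density) (use T in \<open>auto simp: indicator_def\<close>)
  also have "\<dots> = (1 / T) *\<^sub>R (LINT x:{0..<T}|lborel. f x)"
    unfolding set_lebesgue_integral_def by (simp flip: integral_scaleR_right)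
  also have "(LINT x:{0..<T}|lborel. f x) = (LINT x:{0..T}|lborel. f x)"
    unfolding set_lebesgue_integral_def
  proof (rule integral_cong_AE)
    show "AE x in lborel. indicator {0..<T} x *\<^sub>R f x = indicator {0..T} x *\<^sub>R f x"
      using AE_lborel_singleton[of T] by eventually_elim (auto simp: indicator_def)
  qed auto
  also have "\<dots> = integral {0..T} f"
  proof (rule set_borel_integral_eq_integral(2))
    show "set_integrable lborel {0..T} f"
      unfolding set_integrable_def
      by (intro borel_integrable_compact continuous_on_subset[OF cont]) auto
  qed
  finally show ?thesis .
qed
text \<open>Cauchy's formula at the centre; the map is only required to be continuous up to the boundary because the
square roots below may have branch points on the circle itself.\<close>

lemma mean_value_circle_haar:
  assumes cont: "continuous_on (cball 0 1) f" and hol: "f holomorphic_on ball 0 1"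
  shows "(\<integral>z. f z \<partial>circle_haar) = f 0"
proof -
  have sub: "continuous_on (sphere 0 1) f"
    by (rule continuous_on_subset[OF cont]) auto
  have cc: "continuous_on A (\<lambda>t. f (cis t))" for A
    by (rule continuous_on_compose2[OF sub]) (auto intro!: continuous_intros)
  have "((\<lambda>u. f u / (u - 0)) has_contour_integral (2 * of_real pi * \<i> * f 0)) (circlepath 0 1)"
    by (rule Cauchy_integral_circlepath[OF cont hol]) auto
  then have "((\<lambda>x. f (circlepath 0 1 x) / circlepath 0 1 x *
       vector_derivative (circlepath 0 1) (at x within {0..1})) has_integral
       2 * of_real pi * \<i> * f 0) {0..1}"
    by (simp add: has_contour_integral_def)
  then have "((\<lambda>x. (2 * of_real pi * \<i>) * f (cis (2 * pi * x))) has_integral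
       2 * of_real pi * \<i> * f 0) {0..1}"
  proof (rule has_integral_eq[rotated])
    fix x :: real assume "x \<in> {0..1}"
    then have "vector_derivative (circlepath 0 1) (at x within {0..1}) =
        2 * pi * \<i> * 1 * exp (2 * of_real pi * \<i> * x)"
      using vector_derivative_circlepath01[of x 0 1] by simp
    moreover have "circlepath 0 1 x = exp (2 * of_real pi * \<i> * x)"
      by (simp add: circlepath)
    moreover have "cis (2 * pi * x) = exp (2 * of_real pi * \<i> * x)"
      by (simp add: cis_conv_exp mult_ac)
    ultimately show "f (circlepath 0 1 x) / circlepath 0 1 x *
       vector_derivative (circlepath 0 1) (at x within {0..1}) =
       2 * of_real pi * \<i> * f (cis (2 * pi * x))"
      by simp
  qed
  then have I1: "((\<lambda>x. f (cis (2 * pi * x))) has_integral f 0) {0..1}"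
    using has_integral_mult_right_iff[of "2 * of_real pi * \<i>" "\<lambda>x. f (cis (2 * pi * x))" "2 * of_real pi * \<i> * f 0" "{0..1}"]
    by simp
  have "((\<lambda>x. f (cis (2 * pi * x))) has_integral f 0) (cbox 0 1)"
    using I1 by simp
  from has_integral_affinity[OF this, of "1 / (2 * pi)" 0]
  have "((\<lambda>x. f (cis x)) has_integral (2 * pi) *\<^sub>R f 0) ((\<lambda>x. (2 * pi) * x) ` {0..1})"
    by simp
  moreover have "(\<lambda>x. (2 * pi) * x) ` {0..1} = {2 * pi * 0..2 * pi * 1}"
    by (rule image_mult_atLeastAtMost) simp
  ultimately have I2: "((\<lambda>x. f (cis x)) has_integral (2 * pi) *\<^sub>R f 0) {0..2 * pi}"
    by (metis mult_zero_right mult_1_right)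
  have "(\<integral>z. f z \<partial>circle_haar) = (\<integral>x. f (cis x) \<partial>uniform_measure lborel {0..<2 * pi})"
    unfolding circle_haar_def
  proof (rule integral_distr)
    show "cis \<in> uniform_measure lborel {0..<2 * pi} \<rightarrow>\<^sub>M restrict_space borel (sphere 0 1)"
      by (rule measurable_restrict_space2)
         (auto intro!: borel_measurable_continuous_onI continuous_intros
               simp: measurable_cong_sets[OF sets_uniform_measure refl])
    show "f \<in> borel_measurable (restrict_space borel (sphere 0 1))"
      by (rule borel_measurable_continuous_on_restrict[OF sub])
  qed
  also have "\<dots> = (1 / (2 * pi)) *\<^sub>R integral {0..2 * pi} (\<lambda>x. f (cis x))"
    by (rule integral_uniform_interval[OF cc]) simp
  finally show ?thesis
    unfolding integral_unique[OF I2] by simp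
qed

text \<open>The principal square root is discontinuous along the negative axis, but the closed right half plane
meets the branch cut only at \<open>0\<close>, where the root tends to \<open>0\<close>.\<close>

lemma continuous_on_csqrt_halfplane: "continuous_on {z. 0 \<le> Re z} csqrt"
proof (rule continuous_on_eq_continuous_within[THEN iffD2], rule ballI)
  fix z assume "z \<in> {z. 0 \<le> Re z}"
  show "continuous (at z within {z. 0 \<le> Re z}) csqrt"
  proof (cases "z = 0")
    case True
    have "(csqrt \<longlongrightarrow> 0) (at 0 within {z. 0 \<le> Re z})"
    proof (rule tendsto_norm_zero_cancel, rule Lim_at_imp_Lim_at_within)
      show "((\<lambda>x. cmod (csqrt x)) \<longlongrightarrow> 0) (at 0)"
        unfolding norm_csqrt using tendsto_real_sqrt[OF tendsto_norm_zero[OF tendsto_ident_at[of 0 UNIV]]]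
        by simp
    qed
    then show ?thesis using True by (simp add: continuous_within)
  next
    case False
    then have "z \<notin> \<real>\<^sub>\<le>\<^sub>0"
      using \<open>z \<in> {z. 0 \<le> Re z}\<close> by (auto simp: complex_nonpos_Reals_iff complex_eq_iff)
    then show ?thesis by (rule continuous_within_csqrt)
  qed
qed

text \<open>The outer part of \<open>p\<close> is a product of linear factors without roots in the open disc: a factor \<open>z - r\<close>
with \<open>\<bar>r\<bar> < 1\<close> is traded for \<open>1 - cnj r * z\<close>, which has the same modulus on the circle and modulus
\<open>1 > \<bar>r\<bar>\<close> at the centre. Up to constants all factors are then of the form \<open>1 - s * z\<close> with
\<open>\<bar>s\<bar> \<le> 1\<close>. These take values in the right half plane, so \<open>csqrt\<close> may be applied factor by factor, and
\<open>G\<close> is the product of the roots.\<close>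

lemma outer_square_root:
  fixes p :: "complex poly"
  shows "\<exists>G. continuous_on (cball 0 1) G \<and> G holomorphic_on ball 0 1 \<and>
    (\<forall>z\<in>sphere 0 1. (cmod (G z))\<^sup>2 = cmod (poly p z)) \<and> cmod (poly p 0) \<le> (cmod (G 0))\<^sup>2"
proof (induction "degree p" arbitrary: p)
  case 0
  then obtain c where p: "p = [:c:]" by (metis degree_0_id)
  show ?case
    by (rule exI[of _ "\<lambda>_. csqrt c"]) (simp add: p flip: norm_power)
next
  case (Suc n)
  then obtain r where "poly p r = 0"
    using Fundamental_Theorem_Algebra.fundamental_theorem_of_algebra[of p] by (auto simp: constant_degree)
  then obtain q where p: "p = [:-r, 1:] * q"
    by (metis poly_eq_0_iff_dvd dvdE)
  then have "degree q = n"
    using Suc(2) by (subst (asm) p, subst (asm) degree_mult_eq) auto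
  from Suc(1)[OF this[symmetric]] obtain G where G: "continuous_on (cball 0 1) G" "G holomorphic_on ball 0 1"
    "\<And>z. z \<in> sphere 0 1 \<Longrightarrow> (cmod (G z))\<^sup>2 = cmod (poly q z)" "cmod (poly q 0) \<le> (cmod (G 0))\<^sup>2"
    by blast
  \<comment> \<open>On the circle the factor \<open>z - r\<close> has the modulus of \<open>c * (1 - s * z)\<close>, with \<open>s\<close> in the closed disc.\<close>
  define c where "c = (if cmod r < 1 then 1 else -r)"
  define s where "s = (if cmod r < 1 then cnj r else 1 / r)"
  have s: "cmod s \<le> 1" by (auto simp: s_def norm_divide divide_simps)
  have re: "0 \<le> Re (1 - s * z)" if "cmod z \<le> 1" for z
  proof -
    have "Re (s * z) \<le> cmod (s * z)" by (rule complex_Re_le_cmod)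
    also have "\<dots> \<le> 1" using s that by (simp add: norm_mult mult_le_one)
    finally show ?thesis by simp
  qed
  have re': "0 < Re (1 - s * z)" if "cmod z < 1" for z
  proof -
    have "Re (s * z) \<le> cmod (s * z)" by (rule complex_Re_le_cmod)
    also have "\<dots> \<le> cmod z" using s by (simp add: norm_mult mult_left_le_one_le)
    finally show ?thesis using that by simp
  qed
  let ?H = "\<lambda>z. csqrt c * csqrt (1 - s * z) * G z"
  have eq: "cmod (z - r) = cmod c * cmod (1 - s * z)" if "cmod z = 1" for z
  proof (cases "cmod r < 1")
    case True
    have "cmod (1 - cnj r * z) = cmod (cnj z * (z - r))"
    proof -
      have "cnj z * z = 1" using that by (simp add: mult.commute flip: complex_norm_square)
      then have "cnj (1 - cnj r * z) = cnj z * (z - r)" by (simp add: algebra_simps)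
      then show ?thesis by (metis complex_mod_cnj)
    qed
    then show ?thesis using True that by (simp add: c_def s_def norm_mult)
  next
    case False
    then have "r \<noteq> 0" by auto
    then have "z - r = c * (1 - s * z)" using False by (simp add: c_def s_def field_simps)
    then show ?thesis by (metis norm_mult)
  qed
  have 1: "continuous_on (cball 0 1) ?H"
    by (intro continuous_intros G(1) continuous_on_compose2[OF continuous_on_csqrt_halfplane])
       (use re in auto)
  have 2: "?H holomorphic_on ball 0 1"
    by (intro holomorphic_intros G(2))
       (use re' in \<open>force simp: complex_nonpos_Reals_iff\<close>)
  have 3: "(cmod (?H z))\<^sup>2 = cmod (poly p z)" if "z \<in> sphere 0 1" for z
  proof -
    have "poly p z = (z - r) * poly q z"
      by (simp add: p algebra_simps)
    then have "cmod (poly p z) = cmod c * cmod (1 - s * z) * cmod (poly q z)"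
      using eq[of z] that by (simp add: norm_mult)
    moreover have "(cmod (?H z))\<^sup>2 = cmod c * cmod (1 - s * z) * (cmod (G z))\<^sup>2"
      by (simp add: norm_mult power_mult_distrib norm_power[symmetric])
    ultimately show ?thesis using G(3)[OF that] by simp
  qed
  have "cmod r \<le> cmod c" by (simp add: c_def)
  then have 4: "cmod (poly p 0) \<le> (cmod (?H 0))\<^sup>2"
    using G(4) by (simp add: p norm_mult power_mult_distrib norm_power[symmetric] mult_mono)
  show ?case using 1 2 3 4 by blast
qed

text \<open>The mean value property of the analytic function \<open>G\<close> from \<open>outer_square_root\<close>, whose modulus is the square root of
\<open>\<bar>p\<bar>\<close> on the circle and at least that at the centre.\<close>

theorem sqrt_submean_poly:
  "sqrt (cmod (\<integral>z. poly p z \<partial>circle_haar)) \<le> (\<integral>z. sqrt (cmod (poly p z)) \<partial>circle_haar)"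
proof -
  obtain G where G: "continuous_on (cball 0 1) G" "G holomorphic_on ball 0 1"
    "\<And>z. z \<in> sphere 0 1 \<Longrightarrow> (cmod (G z))\<^sup>2 = cmod (poly p z)" "cmod (poly p 0) \<le> (cmod (G 0))\<^sup>2"
    using outer_square_root by blast
  have "(\<integral>z. poly p z \<partial>circle_haar) = poly p 0"
    by (intro mean_value_circle_haar continuous_intros holomorphic_intros)
  moreover have "sqrt (cmod (poly p 0)) \<le> cmod (G 0)"
    using G(4) by (simp add: real_le_lsqrt)
  moreover have "cmod (G 0) \<le> (\<integral>z. cmod (G z) \<partial>circle_haar)"
    by (subst mean_value_circle_haar[OF G(1,2), symmetric]) (rule integral_norm_bound)
  moreover have "(\<integral>z. cmod (G z) \<partial>circle_haar) = (\<integral>z. sqrt (cmod (poly p z)) \<partial>circle_haar)"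
    by (intro Bochner_Integration.integral_cong refl) (simp add: space_circle_haar flip: G(3))
  ultimately show ?thesis by simp
qed

lemma integral_circle_haar_powi:
  "(\<integral>z. z powi k \<partial>circle_haar) = (if k = 0 then 1 else 0)"
proof -
  have nat: "(\<integral>z. z ^ n \<partial>circle_haar) = (if n = 0 then 1 else 0)" for n
    by (subst mean_value_circle_haar) (auto intro!: continuous_intros holomorphic_intros simp: power_0_left)
  show ?thesis
  proof (cases "k \<ge> 0")
    case True
    then show ?thesis using nat[of "nat k"] by (auto simp: power_int_def)
  next
    case False
    have "(\<integral>z. z powi k \<partial>circle_haar) = (\<integral>z. cnj (z ^ nat (-k)) \<partial>circle_haar)"
    proof (intro Bochner_Integration.integral_cong refl)
      fix z assume "z \<in> space circle_haar"
      then have "inverse z = cnj z" by (simp add: space_circle_haar inverse_complex_def complex_eq_iff cmod_def)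
      then show "z powi k = cnj (z ^ nat (-k))" using False by (simp add: power_int_def power_inverse)
    qed
    also have "\<dots> = cnj (\<integral>z. z ^ nat (-k) \<partial>circle_haar)"
      by (rule Bochner_Integration.integral_cnj)
    finally show ?thesis using False nat[of "nat (-k)"] by simp
  qed
qed

section \<open>Characters of the torus\<close>

lemma prob_space_torus: "prob_space (torus I)"
  unfolding torus_def by (intro prob_space_PiM prob_space_circle_haar)

interpretation torus: prob_space "torus I" for I
  by (rule prob_space_torus)

lemma space_torus: "space (torus I) = (\<Pi>\<^sub>E n\<in>I. sphere 0 1)"
  by (simp add: torus_def space_PiM space_circle_haar)

lemma cmod_torus: "z \<in> space (torus I) \<Longrightarrow> n \<in> I \<Longrightarrow> cmod (z n) = 1"
  by (auto simp: space_torus PiE_iff)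

lemma measurable_torus_component [measurable]:
  assumes "n \<in> I"
  shows "(\<lambda>z. z n) \<in> borel_measurable (torus I)"
proof -
  have "(\<lambda>z. z n) \<in> torus I \<rightarrow>\<^sub>M circle_haar"
    unfolding torus_def by (rule measurable_component_singleton[OF assms])
  then show ?thesis
    by (simp add: measurable_cong_sets[OF refl sets_circle_haar] measurable_restrict_space2_iff)
qed

lemma freqsD: "\<nu> \<in> freqs I \<Longrightarrow> \<nu> n \<noteq> 0 \<Longrightarrow> n \<in> I"
  by (auto simp: freqs_def)

lemma freqs_finite: "\<nu> \<in> freqs I \<Longrightarrow> finite {n. \<nu> n \<noteq> 0}"
  by (auto simp: freqs_def)

lemma freqs_mono: "I \<subseteq> J \<Longrightarrow> freqs I \<subseteq> freqs J"
  by (auto simp: freqs_def)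

lemma freqs_add: "\<nu> \<in> freqs I \<Longrightarrow> \<mu> \<in> freqs I \<Longrightarrow> (\<lambda>n. \<nu> n + \<mu> n) \<in> freqs I"
proof -
  assume a: "\<nu> \<in> freqs I" "\<mu> \<in> freqs I"
  have "{n. \<nu> n + \<mu> n \<noteq> 0} \<subseteq> {n. \<nu> n \<noteq> 0} \<union> {n. \<mu> n \<noteq> 0}" by auto
  with a show ?thesis unfolding freqs_def by (auto intro: finite_subset)
qed

lemma freqs_uminus: "\<nu> \<in> freqs I \<Longrightarrow> (\<lambda>n. - \<nu> n) \<in> freqs I"
  by (auto simp: freqs_def)

lemma freqs_diff: "\<nu> \<in> freqs I \<Longrightarrow> \<mu> \<in> freqs I \<Longrightarrow> (\<lambda>n. \<nu> n - \<mu> n) \<in> freqs I"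
  using freqs_add[OF _ freqs_uminus] by simp

text \<open>Products over the support of \<open>\<nu>\<close> are awkward to combine when the supports of two frequencies differ; any finite set containing both may be
used instead.\<close>

lemma monomial_superset:
  assumes "finite S" "{n. \<nu> n \<noteq> 0} \<subseteq> S"
  shows "monomial \<nu> z = (\<Prod>n\<in>S. z n powi \<nu> n)"
  unfolding monomial_def by (rule prod.mono_neutral_left) (use assms in auto)

lemma monomial_measurable [measurable]:
  assumes "\<nu> \<in> freqs I"
  shows "monomial \<nu> \<in> borel_measurable (torus I)"
  unfolding monomial_def
proof (rule borel_measurable_prod)
  fix n assume "n \<in> {n. \<nu> n \<noteq> 0}"
  then have n: "n \<in> I" using freqsD[OF assms] by auto
  show "(\<lambda>z. z n powi \<nu> n) \<in> borel_measurable (torus I)"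
    unfolding power_int_def using n by measurable
qed

lemma cmod_monomial:
  assumes "\<nu> \<in> freqs I" "z \<in> space (torus I)"
  shows "cmod (monomial \<nu> z) = 1"
  unfolding monomial_def prod_norm[symmetric]
  by (rule prod.neutral) (use assms in \<open>auto simp: norm_power_int cmod_torus freqsD\<close>)

lemma monomial_0: "monomial (\<lambda>_. 0) z = 1"
  by (simp add: monomial_def)

lemma monomial_add:
  assumes "\<nu> \<in> freqs I" "\<mu> \<in> freqs I" "z \<in> space (torus I)"
  shows "monomial (\<lambda>n. \<nu> n + \<mu> n) z = monomial \<nu> z * monomial \<mu> z"
proof -
  let ?S = "{n. \<nu> n \<noteq> 0} \<union> {n. \<mu> n \<noteq> 0}"
  have S: "finite ?S" using assms(1,2) by (simp add: freqs_def)
  have nz: "z n \<noteq> 0" if "n \<in> ?S" for n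
    using cmod_torus[OF assms(3), of n] freqsD[OF assms(1), of n] freqsD[OF assms(2), of n] that by auto
  have "monomial (\<lambda>n. \<nu> n + \<mu> n) z = (\<Prod>n\<in>?S. z n powi (\<nu> n + \<mu> n))"
    by (rule monomial_superset[OF S]) auto
  also have "\<dots> = (\<Prod>n\<in>?S. z n powi \<nu> n) * (\<Prod>n\<in>?S. z n powi \<mu> n)"
    unfolding prod.distrib[symmetric] by (rule prod.cong) (auto simp: power_int_add nz)
  also have "\<dots> = monomial \<nu> z * monomial \<mu> z"
    by (simp only: monomial_superset[OF S Un_upper1] monomial_superset[OF S Un_upper2])
  finally show ?thesis .
qed

lemma cnj_monomial:
  assumes "\<nu> \<in> freqs I" "z \<in> space (torus I)"
  shows "cnj (monomial \<nu> z) = monomial (\<lambda>n. - \<nu> n) z"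
proof -
  have "cnj (z n powi \<nu> n) = z n powi (- \<nu> n)" if "\<nu> n \<noteq> 0" for n
  proof -
    have "cmod (z n) = 1" using cmod_torus[OF assms(2)] freqsD[OF assms(1) that] by auto
    then have "z n * cnj (z n) = 1" by (simp flip: complex_norm_square)
    then have "cnj (z n) = inverse (z n)" by (metis inverse_unique)
    then show ?thesis by (simp add: power_int_minus flip: power_int_inverse)
  qed
  then have "(\<Prod>n | \<nu> n \<noteq> 0. cnj (z n powi \<nu> n)) = (\<Prod>n | \<nu> n \<noteq> 0. z n powi (- \<nu> n))"
    by (intro prod.cong) auto
  then show ?thesis by (simp add: monomial_def)
qed

lemma monomial_diff:
  assumes "\<nu> \<in> freqs I" "\<mu> \<in> freqs I" "z \<in> space (torus I)"
  shows "monomial (\<lambda>n. \<nu> n - \<mu> n) z = monomial \<nu> z * cnj (monomial \<mu> z)"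
  using monomial_add[OF assms(1) freqs_uminus[OF assms(2)] assms(3)]
  by (simp add: cnj_monomial[OF assms(2,3)])

lemma integrable_torus_bounded:
  fixes f :: "_ \<Rightarrow> 'b::{banach, second_countable_topology}"
  assumes "f \<in> borel_measurable (torus I)" "\<And>z. z \<in> space (torus I) \<Longrightarrow> norm (f z) \<le> B"
  shows "integrable (torus I) f"
  using assms by (intro torus.integrable_const_bound[of _ B] AE_I2) auto

lemma integrable_monomial: "\<nu> \<in> freqs I \<Longrightarrow> integrable (torus I) (monomial \<nu>)"
  by (rule integrable_torus_bounded[of _ _ 1]) (auto simp: cmod_monomial)

lemma integrable_mult_bounded:
  fixes f g :: "_ \<Rightarrow> 'b::{real_normed_algebra, banach, second_countable_topology}"
  assumes "integrable M f" "g \<in> borel_measurable M" "\<And>z. z \<in> space M \<Longrightarrow> norm (g z) \<le> B"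
  shows "integrable M (\<lambda>z. f z * g z)"
proof (rule Bochner_Integration.integrable_bound[of _ "\<lambda>z. B * norm (f z)"])
  show "AE x in M. norm (f x * g x) \<le> norm (B * norm (f x))"
  proof (rule AE_I2)
    fix x assume "x \<in> space M"
    then have B: "norm (g x) \<le> B" by (rule assms(3))
    then have "0 \<le> B" by (rule order_trans[OF norm_ge_zero])
    moreover have "norm (f x) * norm (g x) \<le> norm (f x) * B" by (rule mult_left_mono[OF B norm_ge_zero])
    ultimately show "norm (f x * g x) \<le> norm (B * norm (f x))"
      by (intro order_trans[OF norm_mult_ineq]) (simp add: mult.commute)
  qed
qed (use assms in auto)

section \<open>Density of trigonometric polynomials\<close>

text \<open>Identities between characters, such as \<open>monomial_add\<close>, hold on the torus but not for arbitrary sequences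
of complex numbers. Closing the class under equality on the torus makes it an algebra.\<close>

inductive trig_poly :: "nat set \<Rightarrow> ((nat \<Rightarrow> complex) \<Rightarrow> complex) \<Rightarrow> bool" for I where
  monomial: "\<nu> \<in> freqs I \<Longrightarrow> trig_poly I (\<lambda>z. c * monomial \<nu> z)"
| add: "trig_poly I p \<Longrightarrow> trig_poly I q \<Longrightarrow> trig_poly I (\<lambda>z. p z + q z)"
| cong: "trig_poly I p \<Longrightarrow> (\<And>z. z \<in> space (torus I) \<Longrightarrow> p z = q z) \<Longrightarrow> trig_poly I q"

lemma zero_freqs: "(\<lambda>_. 0) \<in> freqs I"
  by (simp add: freqs_def)

lemma trig_poly_const: "trig_poly I (\<lambda>_. c)"
  using trig_poly.monomial[OF zero_freqs, of I c] by (simp add: monomial_0)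

lemma trig_poly_mult_monomial:
  assumes "trig_poly I p" "\<nu> \<in> freqs I"
  shows "trig_poly I (\<lambda>z. p z * (c * monomial \<nu> z))"
  using assms(1)
proof induction
  case (monomial \<mu> d)
  have "trig_poly I (\<lambda>z. (d * c) * monomial (\<lambda>n. \<mu> n + \<nu> n) z)"
    by (intro trig_poly.monomial freqs_add monomial assms)
  then show ?case
    by (rule trig_poly.cong) (simp add: monomial_add[OF monomial assms(2)])
next
  case (add p q)
  from trig_poly.add[OF add.IH] show ?case by (simp add: algebra_simps)
next
  case (cong p q)
  from cong.IH show ?case by (rule trig_poly.cong) (simp add: cong.hyps)
qed

lemma trig_poly_mult:
  assumes "trig_poly I q" "trig_poly I p"
  shows "trig_poly I (\<lambda>z. p z * q z)"
  using assms(1)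
proof induction
  case (monomial \<mu> d)
  then show ?case by (rule trig_poly_mult_monomial[OF assms(2)])
next
  case (add p q)
  from trig_poly.add[OF add.IH] show ?case by (simp add: algebra_simps)
next
  case (cong p q)
  from cong.IH show ?case by (rule trig_poly.cong) (simp add: cong.hyps)
qed

lemma trig_poly_measurable:
  "trig_poly I p \<Longrightarrow> p \<in> borel_measurable (torus I)"
proof (induction rule: trig_poly.induct)
  case (cong p q)
  then show ?case using measurable_cong[of "torus I" p q] by blast
qed auto

lemma trig_poly_bounded:
  assumes "trig_poly I p"
  obtains B where "\<And>z. z \<in> space (torus I) \<Longrightarrow> cmod (p z) \<le> B" "0 \<le> B"
proof -
  from assms have "\<exists>B\<ge>0. \<forall>z\<in>space (torus I). cmod (p z) \<le> B"
  proof induction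
    case (monomial \<nu> c)
    then show ?case by (intro exI[of _ "cmod c"]) (auto simp: norm_mult cmod_monomial)
  next
    case (add p q)
    then obtain B B' where "B \<ge> 0" "B' \<ge> 0"
      "\<forall>z\<in>space (torus I). cmod (p z) \<le> B" "\<forall>z\<in>space (torus I). cmod (q z) \<le> B'" by blast
    then show ?case
      by (intro exI[of _ "B + B'"]) (auto intro!: order_trans[OF norm_triangle_ineq] add_mono)
  qed auto
  then show ?thesis using that by blast
qed

lemma trig_poly_integrable: "trig_poly I p \<Longrightarrow> integrable (torus I) p"
  by (metis trig_poly_bounded trig_poly_measurable integrable_torus_bounded)

definition trig_approximable :: "nat set \<Rightarrow> ((nat \<Rightarrow> complex) \<Rightarrow> complex) \<Rightarrow> bool" where
  "trig_approximable I f \<longleftrightarrow> integrable (torus I) f \<and>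
     (\<forall>e>0. \<exists>p. trig_poly I p \<and> (\<integral>z. cmod (f z - p z) \<partial>torus I) < e)"

lemma trig_approximable_trig_poly: "trig_poly I p \<Longrightarrow> trig_approximable I p"
  unfolding trig_approximable_def by (auto simp: trig_poly_integrable intro!: exI[of _ p])

lemma L1_triangle:
  fixes f g h :: "_ \<Rightarrow> 'b::{banach, second_countable_topology}"
  assumes "integrable M f" "integrable M g" "integrable M h"
  shows "(\<integral>z. norm (f z - h z) \<partial>M) \<le> (\<integral>z. norm (f z - g z) \<partial>M) + (\<integral>z. norm (g z - h z) \<partial>M)"
proof -
  have "(\<integral>z. norm (f z - h z) \<partial>M) \<le> (\<integral>z. norm (f z - g z) + norm (g z - h z) \<partial>M)"
  proof (rule integral_mono)
    show "norm (f z - h z) \<le> norm (f z - g z) + norm (g z - h z)" for z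
      using dist_triangle[of "f z" "h z" "g z"] by (simp add: dist_norm)
  qed (use assms in auto)
  also have "\<dots> = (\<integral>z. norm (f z - g z) \<partial>M) + (\<integral>z. norm (g z - h z) \<partial>M)"
    using assms by (intro Bochner_Integration.integral_add) auto
  finally show ?thesis .
qed

lemma trig_approximable_closed:
  assumes f: "integrable (torus I) f"
    and g: "\<And>e. e > 0 \<Longrightarrow> \<exists>g. trig_approximable I g \<and> (\<integral>z. cmod (f z - g z) \<partial>torus I) < e"
  shows "trig_approximable I f"
  unfolding trig_approximable_def
proof (intro conjI allI impI f)
  fix e :: real assume "e > 0"
  then obtain g where g: "trig_approximable I g" "(\<integral>z. cmod (f z - g z) \<partial>torus I) < e / 2"
    using g[of "e / 2"] by auto
  then obtain p where p: "trig_poly I p" "(\<integral>z. cmod (g z - p z) \<partial>torus I) < e / 2"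
    using \<open>e > 0\<close> half_gt_zero unfolding trig_approximable_def by blast
  have "integrable (torus I) g" using g by (simp add: trig_approximable_def)
  from L1_triangle[OF f this trig_poly_integrable[OF p(1)]] g(2) p
  show "\<exists>p. trig_poly I p \<and> (\<integral>z. cmod (f z - p z) \<partial>torus I) < e" by force
qed

lemma trig_approximable_add:
  assumes "trig_approximable I f" "trig_approximable I g"
  shows "trig_approximable I (\<lambda>z. f z + g z)"
  unfolding trig_approximable_def
proof (intro conjI allI impI)
  have int: "integrable (torus I) f" "integrable (torus I) g" using assms by (auto simp: trig_approximable_def)
  then show "integrable (torus I) (\<lambda>z. f z + g z)" by simp
  fix e :: real assume "e > 0"
  then obtain p q where p: "trig_poly I p" "(\<integral>z. cmod (f z - p z) \<partial>torus I) < e / 2"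
    and q: "trig_poly I q" "(\<integral>z. cmod (g z - q z) \<partial>torus I) < e / 2"
    using assms half_gt_zero unfolding trig_approximable_def by blast
  note int = int trig_poly_integrable[OF p(1)] trig_poly_integrable[OF q(1)]
  have "(\<integral>z. cmod (f z + g z - (p z + q z)) \<partial>torus I) \<le> (\<integral>z. cmod (f z - p z) + cmod (g z - q z) \<partial>torus I)"
    using int by (intro integral_mono norm_diff_triangle_ineq) auto
  also have "\<dots> = (\<integral>z. cmod (f z - p z) \<partial>torus I) + (\<integral>z. cmod (g z - q z) \<partial>torus I)"
    using int by (intro Bochner_Integration.integral_add) auto
  finally show "\<exists>p. trig_poly I p \<and> (\<integral>z. cmod (f z + g z - p z) \<partial>torus I) < e"
    using p q by (intro exI[of _ "\<lambda>z. p z + q z"]) (auto intro: trig_poly.add)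
qed

lemma trig_approximable_cong:
  assumes "trig_approximable I f" "\<And>z. z \<in> space (torus I) \<Longrightarrow> f z = g z"
  shows "trig_approximable I g"
proof -
  have "integrable (torus I) f \<longleftrightarrow> integrable (torus I) g"
    by (rule Bochner_Integration.integrable_cong) (auto simp: assms)
  moreover have "(\<integral>z. cmod (f z - p z) \<partial>torus I) = (\<integral>z. cmod (g z - p z) \<partial>torus I)" for p
    by (rule Bochner_Integration.integral_cong) (auto simp: assms)
  ultimately show ?thesis using assms(1) by (simp add: trig_approximable_def)
qed

text \<open>This is why the measurable sets with approximable indicator form a \<open>\<sigma>\<close>-algebra. Boundedness of
one factor suffices: first replace the other factor by a trigonometric polynomial, which is bounded as
well, and then the bounded one.\<close>

lemma trig_approximable_mult:
  assumes f: "trig_approximable I f" and g: "trig_approximable I g"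
    and B: "\<And>z. z \<in> space (torus I) \<Longrightarrow> cmod (f z) \<le> B"
  shows "trig_approximable I (\<lambda>z. f z * g z)"
proof (rule trig_approximable_closed)
  have int: "integrable (torus I) f" "integrable (torus I) g" using assms by (auto simp: trig_approximable_def)
  then have "integrable (torus I) (\<lambda>z. g z * f z)"
    by (intro integrable_mult_bounded[where B = B] B) auto
  then show fg: "integrable (torus I) (\<lambda>z. f z * g z)" by (simp add: mult.commute)
  have fq: "trig_approximable I (\<lambda>z. f z * q z)" if q: "trig_poly I q" for q
    unfolding trig_approximable_def
  proof (intro conjI allI impI)
    from q obtain B' where B': "\<And>z. z \<in> space (torus I) \<Longrightarrow> cmod (q z) \<le> B'" "0 \<le> B'"
      using trig_poly_bounded by blast
    show fq: "integrable (torus I) (\<lambda>z. f z * q z)"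
      by (intro integrable_mult_bounded[where B = B'] B' int trig_poly_measurable q)
    fix e :: real assume "e > 0"
    then have "e / (B' + 1) > 0" using B' by simp
    then obtain p where p: "trig_poly I p" "(\<integral>z. cmod (f z - p z) \<partial>torus I) < e / (B' + 1)"
      using f unfolding trig_approximable_def by blast
    note pi = trig_poly_integrable[OF p(1)]
    note pq = trig_poly_mult[OF q p(1)]
    have "(\<integral>z. cmod (f z * q z - p z * q z) \<partial>torus I) \<le> (\<integral>z. (B' + 1) * cmod (f z - p z) \<partial>torus I)"
    proof (rule integral_mono)
      fix z assume "z \<in> space (torus I)"
      then have "cmod (q z) \<le> B' + 1" using B'(1)[of z] by simp
      then have "cmod (q z) * cmod (f z - p z) \<le> (B' + 1) * cmod (f z - p z)"
        by (rule mult_right_mono) simp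
      then show "cmod (f z * q z - p z * q z) \<le> (B' + 1) * cmod (f z - p z)"
        by (simp add: norm_mult[symmetric] algebra_simps)
    qed (use int fq pi trig_poly_integrable[OF pq] in auto)
    also have "\<dots> = (B' + 1) * (\<integral>z. cmod (f z - p z) \<partial>torus I)" by simp
    also have "\<dots> < e" using p(2) B'(2) by (simp add: field_simps)
    finally show "\<exists>p. trig_poly I p \<and> (\<integral>z. cmod (f z * q z - p z) \<partial>torus I) < e"
      using pq by blast
  qed
  fix e :: real assume "e > 0"
  define B' where "B' = \<bar>B\<bar> + 1"
  have "e / B' > 0" using \<open>e > 0\<close> by (simp add: B'_def)
  then obtain q where q: "trig_poly I q" "(\<integral>z. cmod (g z - q z) \<partial>torus I) < e / B'"
    using g unfolding trig_approximable_def by blast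
  have "(\<integral>z. cmod (f z * g z - f z * q z) \<partial>torus I) \<le> (\<integral>z. B' * cmod (g z - q z) \<partial>torus I)"
  proof (rule integral_mono)
    fix z assume "z \<in> space (torus I)"
    then have "cmod (f z) \<le> B'" using B[of z] by (simp add: B'_def)
    then have "cmod (f z) * cmod (g z - q z) \<le> B' * cmod (g z - q z)"
      by (rule mult_right_mono) simp
    then show "cmod (f z * g z - f z * q z) \<le> B' * cmod (g z - q z)"
      by (simp add: norm_mult[symmetric] algebra_simps)
  qed (use int fg fq[OF q(1)] trig_poly_integrable[OF q(1)] in \<open>auto simp: trig_approximable_def\<close>)
  also have "\<dots> = B' * (\<integral>z. cmod (g z - q z) \<partial>torus I)" by simp
  also have "\<dots> < e" using q(2) by (simp add: field_simps B'_def)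
  finally show "\<exists>h. trig_approximable I h \<and> (\<integral>z. cmod (f z * g z - h z) \<partial>torus I) < e"
    using fq[OF q(1)] by blast
qed

lemma LIMSEQ_zero_ex_less:
  fixes X :: "nat \<Rightarrow> real"
  assumes "X \<longlonglongrightarrow> 0" "e > 0"
  shows "\<exists>n. X n < e"
  using eventually_happens'[OF sequentially_bot order_tendstoD(2)[OF assms]] .

lemma trig_approximable_bounded_limit:
  assumes f: "\<And>n. trig_approximable I (f n)"
    and B: "\<And>n z. z \<in> space (torus I) \<Longrightarrow> cmod (f n z) \<le> B"
    and lim: "\<And>z. z \<in> space (torus I) \<Longrightarrow> (\<lambda>n. f n z) \<longlonglongrightarrow> g z"
  shows "trig_approximable I g"
proof (rule trig_approximable_closed)
  have m: "f n \<in> borel_measurable (torus I)" for n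
    using f[of n] by (auto simp: trig_approximable_def)
  then have gm: "g \<in> borel_measurable (torus I)" by (rule borel_measurable_LIMSEQ_metric[OF _ lim])
  have Bg: "cmod (g z) \<le> B" if "z \<in> space (torus I)" for z
    using B[OF that] by (intro LIMSEQ_le_const2[OF tendsto_norm[OF lim[OF that]]]) auto
  show "integrable (torus I) g" by (rule integrable_torus_bounded[OF gm Bg])
  have "(\<lambda>n. \<integral>z. cmod (g z - f n z) \<partial>torus I) \<longlonglongrightarrow> (\<integral>z. 0 \<partial>torus I)"
  proof (rule integral_dominated_convergence[where w = "\<lambda>_. 2 * B"])
    show "AE z in torus I. (\<lambda>n. cmod (g z - f n z)) \<longlonglongrightarrow> 0"
    proof (rule AE_I2)
      fix z assume "z \<in> space (torus I)"
      from tendsto_norm[OF tendsto_diff[OF tendsto_const[of "g z"] lim[OF this]]]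
      show "(\<lambda>n. cmod (g z - f n z)) \<longlonglongrightarrow> 0" by simp
    qed
    show "AE z in torus I. norm (cmod (g z - f n z)) \<le> 2 * B" for n
    proof (rule AE_I2)
      fix z assume z: "z \<in> space (torus I)"
      show "norm (cmod (g z - f n z)) \<le> 2 * B"
        using norm_triangle_ineq4[of "g z" "f n z"] Bg[OF z] B[OF z, of n] by simp
    qed
  qed (use m gm in auto)
  then have "(\<lambda>n. \<integral>z. cmod (g z - f n z) \<partial>torus I) \<longlonglongrightarrow> 0" by simp
  then have "\<exists>n. (\<integral>z. cmod (g z - f n z) \<partial>torus I) < e" if "e > 0" for e
    using that by (rule LIMSEQ_zero_ex_less)
  then show "\<exists>h. trig_approximable I h \<and> (\<integral>z. cmod (g z - h z) \<partial>torus I) < e" if "e > 0" for e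
    using f that by blast
qed

lemma trig_approximable_Not:
  assumes "trig_approximable I (\<lambda>z. of_bool (P z))"
  shows "trig_approximable I (\<lambda>z. of_bool (\<not> P z))"
proof -
  have "trig_approximable I (\<lambda>z. of_bool (P z) * (-1))"
    by (rule trig_approximable_mult[OF assms, where B = 1])
       (auto intro: trig_approximable_trig_poly trig_poly_const)
  from trig_approximable_add[OF trig_approximable_trig_poly[OF trig_poly_const[of I 1]] this]
  show ?thesis by (rule trig_approximable_cong) auto
qed

text \<open>Closure under countable unions. A finite intersection of complements is a product of
approximable indicators, and the infinite one is a bounded pointwise limit of these.\<close>

lemma trig_approximable_Ex:
  fixes P :: "nat \<Rightarrow> _ \<Rightarrow> bool"
  assumes "\<And>i. trig_approximable I (\<lambda>z. of_bool (P i z))"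
  shows "trig_approximable I (\<lambda>z. of_bool (\<exists>i. P i z))"
proof -
  have "trig_approximable I (\<lambda>z. of_bool (\<forall>i<n. \<not> P i z))" for n
  proof (induction n)
    case 0
    then show ?case using trig_approximable_trig_poly[OF trig_poly_const[of I 1]] by simp
  next
    case (Suc n)
    from trig_approximable_mult[OF this trig_approximable_Not[OF assms[of n]], of 1]
    have "trig_approximable I (\<lambda>z. of_bool (\<forall>i<n. \<not> P i z) * of_bool (\<not> P n z))"
      by (simp add: of_bool_def)
    then show ?case
      by (rule trig_approximable_cong) (simp add: All_less_Suc flip: of_bool_conj)
  qed
  then have "trig_approximable I (\<lambda>z. of_bool (\<forall>i. \<not> P i z))"
  proof (rule trig_approximable_bounded_limit[where B = 1])
    fix z
    show "(\<lambda>n. of_bool (\<forall>i<n. \<not> P i z)) \<longlonglongrightarrow> (of_bool (\<forall>i. \<not> P i z) :: complex)"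
    proof (cases "\<forall>i. \<not> P i z")
      case False
      then obtain i where "P i z" by auto
      have "\<forall>\<^sub>F n in sequentially. of_bool (\<forall>i<n. \<not> P i z) = (of_bool (\<forall>i. \<not> P i z) :: complex)"
        using eventually_gt_at_top[of i]
      proof eventually_elim
        case (elim n)
        then have "\<not> (\<forall>i<n. \<not> P i z)" "\<not> (\<forall>i. \<not> P i z)" using \<open>P i z\<close> by blast+
        then show ?case by (simp only: of_bool_def)
      qed
      then show ?thesis by (rule tendsto_eventually)
    qed simp
    show "cmod (of_bool (\<forall>i<n. \<not> P i z)) \<le> 1" for n
      by (simp add: of_bool_def)
  qed
  from trig_approximable_Not[OF this] show ?thesis by (simp only: not_all not_not)
qed

text \<open>By the Stone-Weierstrass theorem \<open>\<phi>\<close> is uniformly close on the circle to a polynomial in the real and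
imaginary parts, and such a polynomial is a trigonometric polynomial since \<open>cnj w = inverse w\<close> there.\<close>

lemma trig_approximable_continuous:
  fixes \<phi> :: "complex \<Rightarrow> real"
  assumes cont: "continuous_on (sphere 0 1) \<phi>" and i: "i \<in> I"
  shows "trig_approximable I (\<lambda>z. of_real (\<phi> (z i)))"
proof -
  have coord: "trig_poly I (\<lambda>z. z i)" "trig_poly I (\<lambda>z. cnj (z i))"
  proof -
    let ?\<nu> = "\<lambda>n. if n = i then 1 else 0 :: int"
    have \<nu>: "?\<nu> \<in> freqs I" using i by (auto simp: freqs_def)
    have m: "monomial ?\<nu> z = z i" for z by (simp add: monomial_def)
    from trig_poly.monomial[OF \<nu>, of 1] show "trig_poly I (\<lambda>z. z i)" by (simp add: m)
    from trig_poly.monomial[OF freqs_uminus[OF \<nu>], of 1] show "trig_poly I (\<lambda>z. cnj (z i))"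
      by (rule trig_poly.cong) (use cnj_monomial[OF \<nu>] in \<open>simp add: m\<close>)
  qed
  have poly: "trig_poly I (\<lambda>z. of_real (p (z i)))" if "real_polynomial_function p" for p
    using that
  proof induction
    case (linear f)
    \<comment> \<open>A real-linear form on the plane is \<open>w \<mapsto> 2 Re (c * w)\<close> for this \<open>c\<close>.\<close>
    define c where "c = (of_real (f 1) - \<i> * of_real (f \<i>)) / 2"
    have "of_real (f w) = c * w + cnj c * cnj w" for w
    proof -
      interpret bounded_linear f by fact
      have "w = Re w *\<^sub>R 1 + Im w *\<^sub>R \<i>" by (simp add: complex_eq_iff)
      then have "f w = Re w * f 1 + Im w * f \<i>" by (metis add scale real_scaleR_def)
      then show ?thesis by (simp add: complex_eq_iff c_def field_simps)
    qed
    moreover have "trig_poly I (\<lambda>z. c * z i + cnj c * cnj (z i))"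
      by (intro trig_poly.add trig_poly_mult coord trig_poly_const)
    ultimately show ?case by simp
  next
    case (const c)
    then show ?case by (rule trig_poly_const)
  next
    case (add f g)
    then show ?case using trig_poly.add by fastforce
  next
    case (mult f g)
    then show ?case using trig_poly_mult by fastforce
  qed
  show ?thesis
  proof (rule trig_approximable_closed)
    have "compact (\<phi> ` sphere 0 1)" using cont by (intro compact_continuous_image) auto
    then obtain B where B: "\<And>w. w \<in> sphere 0 1 \<Longrightarrow> norm (\<phi> w) \<le> B"
      by (meson compact_imp_bounded bounded_iff imageI)
    have "(\<lambda>z. \<phi> (z i)) \<in> borel_measurable (torus I)"
    proof (rule measurable_compose[where f = "\<lambda>z. z i" and g = \<phi> and N = circle_haar])
      show "(\<lambda>z. z i) \<in> torus I \<rightarrow>\<^sub>M circle_haar"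
        unfolding torus_def by (rule measurable_component_singleton[OF i])
      show "\<phi> \<in> borel_measurable circle_haar" by (rule borel_measurable_circle_haar[OF cont])
    qed
    then show int: "integrable (torus I) (\<lambda>z. complex_of_real (\<phi> (z i)))"
      by (intro integrable_torus_bounded[where B = B]) (auto simp: cmod_torus i intro!: B[simplified])
    fix e :: real assume "e > 0"
    then have "e / 2 > 0" by simp
    from Stone_Weierstrass_real_polynomial_function[OF _ cont this]
    obtain p where p: "real_polynomial_function p" "\<And>w. w \<in> sphere 0 1 \<Longrightarrow> \<bar>\<phi> w - p w\<bar> < e / 2"
      by auto
    note tp = poly[OF p(1)]
    have "(\<integral>z. cmod (of_real (\<phi> (z i)) - of_real (p (z i))) \<partial>torus I) \<le> (\<integral>z. e / 2 \<partial>torus I)"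
    proof (rule integral_mono)
      fix z assume "z \<in> space (torus I)"
      then have "z i \<in> sphere 0 1" using i cmod_torus by simp
      from p(2)[OF this] show "cmod (of_real (\<phi> (z i)) - of_real (p (z i))) \<le> e / 2"
        by (simp flip: of_real_diff)
    qed (use int trig_poly_integrable[OF tp] in auto)
    also have "\<dots> < e" using \<open>e > 0\<close> by (simp add: torus.prob_space)
    finally show "\<exists>h. trig_approximable I h \<and> (\<integral>z. cmod (of_real (\<phi> (z i)) - h z) \<partial>torus I) < e"
      using trig_approximable_trig_poly[OF tp] by blast
  qed
qed

text \<open>The indicator of an open set is the limit of the continuous functions
\<open>min 1 (n * infdist w (- U))\<close>, and open sets generate the Borel sets.\<close>

lemma trig_approximable_coordinate_event:
  assumes "B \<in> sets borel" and i: "i \<in> I"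
  shows "trig_approximable I (\<lambda>z. of_bool (z i \<in> B))"
proof -
  have "B \<in> sigma_sets UNIV {S :: complex set. open S}"
    using assms(1) unfolding borel_def by (simp add: sets_measure_of)
  then show ?thesis
  proof induction
    case (Basic U)
    show ?case
    proof (cases "U = UNIV")
      case True
      then show ?thesis using trig_approximable_trig_poly[OF trig_poly_const[of I 1]] by simp
    next
      case False
      \<comment> \<open>\<open>U \<noteq> UNIV\<close> matters here: \<open>infdist\<close> to the empty set is \<open>0\<close> by convention.\<close>
      define f where "f n w = min 1 (real n * infdist w (- U))" for n w
      have "trig_approximable I (\<lambda>z. of_real (f n (z i)))" for n
        unfolding f_def by (intro trig_approximable_continuous i continuous_intros)
      then show ?thesis
      proof (rule trig_approximable_bounded_limit[where B = 1])
        show "cmod (of_real (f n (z i))) \<le> 1" for n z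
          by (simp add: f_def infdist_nonneg)
        fix z
        show "(\<lambda>n. complex_of_real (f n (z i))) \<longlonglongrightarrow> of_bool (z i \<in> U)"
        proof (cases "z i \<in> U")
          case True
          have "infdist (z i) (- U) > 0"
            using True Basic False in_closed_iff_infdist_zero[of "- U" "z i"] infdist_nonneg[of "z i" "- U"]
            by (auto simp: closed_Compl less_le)
          moreover have "\<forall>\<^sub>F n in sequentially. 1 / infdist (z i) (- U) \<le> real n"
            using filterlim_real_sequentially by (simp add: filterlim_at_top)
          ultimately have "\<forall>\<^sub>F n in sequentially. 1 \<le> real n * infdist (z i) (- U)"
            by (simp add: divide_le_eq)
          then have "\<forall>\<^sub>F n in sequentially. complex_of_real (f n (z i)) = of_bool (z i \<in> U)"
            by eventually_elim (use True in \<open>simp add: f_def\<close>)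
          then show ?thesis by (rule tendsto_eventually)
        qed (simp add: f_def)
      qed
    qed
  next
    case Empty
    then show ?case using trig_approximable_trig_poly[OF trig_poly_const[of I 0]] by simp
  next
    case (Compl a)
    from trig_approximable_Not[OF Compl.IH] show ?case by simp
  next
    case (Union a)
    from trig_approximable_Ex[OF Union.IH] show ?case by simp
  qed
qed

lemma trig_approximable_event:
  assumes "A \<in> sets (torus I)"
  shows "trig_approximable I (\<lambda>z. of_bool (z \<in> A))"
proof -
  have "A \<in> sigma_sets (\<Pi>\<^sub>E n\<in>I. space circle_haar)
    {{f \<in> \<Pi>\<^sub>E n\<in>I. space circle_haar. f i \<in> B} | i B. i \<in> I \<and> B \<in> sets circle_haar}"
    using assms unfolding torus_def by (simp add: sets_PiM_single)
  then show ?thesis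
  proof induction
    case (Basic A)
    then obtain i B where A: "A = {f \<in> \<Pi>\<^sub>E n\<in>I. space circle_haar. f i \<in> B}" "i \<in> I" "B \<in> sets circle_haar"
      by auto
    have "B \<in> (\<inter>) (sphere 0 1) ` sets borel"
      using A(3) by (simp only: sets_circle_haar sets_restrict_space)
    then obtain B' where B': "B' \<in> sets borel" "B = sphere 0 1 \<inter> B'"
      by blast
    from trig_approximable_coordinate_event[OF B'(1) A(2)] show ?case
    proof (rule trig_approximable_cong)
      fix z assume z: "z \<in> space (torus I)"
      then have "z i \<in> sphere 0 1" using A(2) by (auto simp: space_torus)
      then have "z \<in> A \<longleftrightarrow> z i \<in> B'"
        using z by (simp add: A(1) B' space_torus space_circle_haar)
      then show "of_bool (z i \<in> B') = of_bool (z \<in> A)" by simp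
    qed
  next
    case Empty
    then show ?case using trig_approximable_trig_poly[OF trig_poly_const[of I 0]] by simp
  next
    case (Compl a)
    from trig_approximable_Not[OF Compl.IH] show ?case
      by (rule trig_approximable_cong) (simp add: space_torus space_circle_haar)
  next
    case (Union a)
    from trig_approximable_Ex[OF Union.IH] show ?case by simp
  qed
qed

text \<open>Density of trigonometric polynomials in \<open>L\<^sup>1\<close>, for an arbitrary index set: indicators of events are approximable by the
preceding lemmas, and simple functions are dense.\<close>

theorem integrable_imp_trig_approximable:
  "integrable (torus I) f \<Longrightarrow> trig_approximable I f"
proof (induction rule: integrable_induct)
  case (base A c)
  have "trig_approximable I (\<lambda>z. of_bool (z \<in> A) * c)"
    by (rule trig_approximable_mult[where B = 1])
       (auto intro: trig_approximable_event base trig_approximable_trig_poly trig_poly_const)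
  then show ?case by (rule trig_approximable_cong) (auto simp: indicator_def)
next
  case (add f g)
  show ?case by (rule trig_approximable_add) fact+
next
  case (lim f s)
  show ?case
  proof (rule trig_approximable_closed)
    show f: "integrable (torus I) f" by fact
    have m: "s n \<in> borel_measurable (torus I)" for n by (rule borel_measurable_integrable[OF lim(1)])
    have "(\<lambda>n. \<integral>z. cmod (f z - s n z) \<partial>torus I) \<longlonglongrightarrow> (\<integral>z. 0 \<partial>torus I)"
    proof (rule integral_dominated_convergence[where w = "\<lambda>z. 3 * cmod (f z)"])
      show "AE z in torus I. (\<lambda>n. cmod (f z - s n z)) \<longlonglongrightarrow> 0"
      proof (rule AE_I2)
        fix z assume "z \<in> space (torus I)"
        from tendsto_norm[OF tendsto_diff[OF tendsto_const[of "f z"] lim(2)[OF this]]]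
        show "(\<lambda>n. cmod (f z - s n z)) \<longlonglongrightarrow> 0" by simp
      qed
      show "AE z in torus I. norm (cmod (f z - s n z)) \<le> 3 * cmod (f z)" for n
      proof (rule AE_I2)
        fix z assume z: "z \<in> space (torus I)"
        show "norm (cmod (f z - s n z)) \<le> 3 * cmod (f z)"
          using norm_triangle_ineq4[of "f z" "s n z"] lim(3)[OF z, of n] by simp
      qed
    qed (use m f in auto)
    then have "(\<lambda>n. \<integral>z. cmod (f z - s n z) \<partial>torus I) \<longlonglongrightarrow> 0" by simp
    then have "\<exists>n. (\<integral>z. cmod (f z - s n z) \<partial>torus I) < e" if "e > 0" for e
      using that by (rule LIMSEQ_zero_ex_less)
    then show "\<exists>h. trig_approximable I h \<and> (\<integral>z. cmod (f z - h z) \<partial>torus I) < e" if "e > 0" for e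
      using lim(5) that by blast
  qed
qed

section \<open>Fourier coefficients\<close>

interpretation circles: product_sigma_finite "\<lambda>_::nat. circle_haar"
  by standard

lemma integral_monomial:
  assumes "finite I" "\<nu> \<in> freqs I"
  shows "(\<integral>z. monomial \<nu> z \<partial>torus I) = of_bool (\<nu> = (\<lambda>_. 0))"
proof -
  have supp: "{n. \<nu> n \<noteq> 0} \<subseteq> I" using assms(2) by (simp add: freqs_def)
  have cont: "continuous_on (sphere 0 1) (\<lambda>z::complex. z powi k)" for k :: int
    by (cases "k \<ge> 0") (auto simp: power_int_def intro!: continuous_intros)
  have "(\<integral>z. monomial \<nu> z \<partial>torus I) = (\<integral>z. (\<Prod>n\<in>I. z n powi \<nu> n) \<partial>PiM I (\<lambda>_. circle_haar))"
    by (simp add: monomial_superset[OF assms(1) supp] torus_def)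
  also have "\<dots> = (\<Prod>n\<in>I. \<integral>z. z powi \<nu> n \<partial>circle_haar)"
    by (rule circles.product_integral_prod[OF assms(1)]) (intro integrable_circle_haar cont)
  also have "\<dots> = of_bool (\<forall>n\<in>I. \<nu> n = 0)"
    using assms(1) by (simp add: integral_circle_haar_powi prod_zero_iff)
  also have "(\<forall>n\<in>I. \<nu> n = 0) \<longleftrightarrow> \<nu> = (\<lambda>_. 0)"
    using supp by (auto simp: fun_eq_iff)
  finally show ?thesis .
qed

lemma integrable_fourier:
  assumes "integrable (torus I) f" "\<nu> \<in> freqs I"
  shows "integrable (torus I) (\<lambda>z. f z * cnj (monomial \<nu> z))"
proof (rule integrable_mult_bounded[OF assms(1)])
  show "(\<lambda>z. cnj (monomial \<nu> z)) \<in> borel_measurable (torus I)"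
    by (rule borel_measurable_continuous_on[OF _ monomial_measurable[OF assms(2)]]) (intro continuous_intros)
  show "z \<in> space (torus I) \<Longrightarrow> norm (cnj (monomial \<nu> z)) \<le> 1" for z
    by (simp add: cmod_monomial[OF assms(2)])
qed

lemma fourier_coeff_cong:
  "(\<And>z. z \<in> space (torus I) \<Longrightarrow> f z = g z) \<Longrightarrow> fourier_coeff I f \<nu> = fourier_coeff I g \<nu>"
  unfolding fourier_coeff_def by (rule Bochner_Integration.integral_cong) auto

lemma fourier_coeff_add:
  assumes "integrable (torus I) f" "integrable (torus I) g" "\<nu> \<in> freqs I"
  shows "fourier_coeff I (\<lambda>z. f z + g z) \<nu> = fourier_coeff I f \<nu> + fourier_coeff I g \<nu>"
  unfolding fourier_coeff_def distrib_right
  by (rule Bochner_Integration.integral_add) (intro integrable_fourier assms)+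

lemma fourier_coeff_diff:
  assumes "integrable (torus I) f" "integrable (torus I) g" "\<nu> \<in> freqs I"
  shows "fourier_coeff I (\<lambda>z. f z - g z) \<nu> = fourier_coeff I f \<nu> - fourier_coeff I g \<nu>"
  unfolding fourier_coeff_def left_diff_distrib
  by (rule Bochner_Integration.integral_diff) (intro integrable_fourier assms)+

lemma fourier_coeff_monomial:
  assumes "finite I" "\<nu> \<in> freqs I" "\<mu> \<in> freqs I"
  shows "fourier_coeff I (\<lambda>z. c * monomial \<nu> z) \<mu> = c * of_bool (\<mu> = \<nu>)"
proof -
  have "fourier_coeff I (\<lambda>z. c * monomial \<nu> z) \<mu> = (\<integral>z. c * monomial (\<lambda>n. \<nu> n - \<mu> n) z \<partial>torus I)"
    unfolding fourier_coeff_def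
    by (rule Bochner_Integration.integral_cong) (simp_all add: monomial_diff[OF assms(2,3)])
  also have "\<dots> = c * of_bool ((\<lambda>n. \<nu> n - \<mu> n) = (\<lambda>_. 0))"
    by (simp only: integral_mult_right_zero integral_monomial[OF assms(1) freqs_diff[OF assms(2,3)]])
  also have "((\<lambda>n. \<nu> n - \<mu> n) = (\<lambda>_. 0)) \<longleftrightarrow> \<mu> = \<nu>"
    by (auto simp: fun_eq_iff)
  finally show ?thesis .
qed

section \<open>Fejer means\<close>

text \<open>These boxes are a Folner sequence in \<open>\<int>\<^sup>m\<close>: a fixed translation moves only a vanishing proportion of
the box outside itself (\<open>freq_box_overlap\<close>).\<close>

definition freq_box :: "nat \<Rightarrow> nat \<Rightarrow> (nat \<Rightarrow> int) set" where
  "freq_box m N = {\<alpha>. (\<forall>n<m. \<alpha> n \<in> {0..int N}) \<and> (\<forall>n\<ge>m. \<alpha> n = 0)}"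

lemma card_finitely_supported:
  fixes S :: "nat \<Rightarrow> int set"
  assumes "\<And>n. n < m \<Longrightarrow> finite (S n)"
  shows "finite {\<alpha>. (\<forall>n<m. \<alpha> n \<in> S n) \<and> (\<forall>n\<ge>m. \<alpha> n = 0)}" (is "finite ?A")
    and "card {\<alpha>. (\<forall>n<m. \<alpha> n \<in> S n) \<and> (\<forall>n\<ge>m. \<alpha> n = 0)} = (\<Prod>n<m. card (S n))"
proof -
  have bij: "bij_betw (\<lambda>\<alpha>. restrict \<alpha> {..<m}) ?A (PiE {..<m} S)"
  proof (rule bij_betw_byWitness[where f' = "\<lambda>\<beta> n. if n < m then \<beta> n else 0"])
    show "\<forall>\<alpha>\<in>?A. (\<lambda>n. if n < m then restrict \<alpha> {..<m} n else 0) = \<alpha>"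
    proof
      fix \<alpha> assume "\<alpha> \<in> ?A"
      then show "(\<lambda>n. if n < m then restrict \<alpha> {..<m} n else 0) = \<alpha>"
        by (intro ext) (simp add: not_less)
    qed
    show "\<forall>\<beta>\<in>PiE {..<m} S. restrict (\<lambda>n. if n < m then \<beta> n else 0) {..<m} = \<beta>"
    proof
      fix \<beta> assume \<beta>: "\<beta> \<in> PiE {..<m} S"
      show "restrict (\<lambda>n. if n < m then \<beta> n else 0) {..<m} = \<beta>"
        by (rule ext) (simp add: restrict_def PiE_arb[OF \<beta>])
    qed
    show "(\<lambda>\<alpha>. restrict \<alpha> {..<m}) ` ?A \<subseteq> PiE {..<m} S"
      by (rule image_subsetI) (simp add: restrict_PiE_iff)
    show "(\<lambda>\<beta> n. if n < m then \<beta> n else 0) ` PiE {..<m} S \<subseteq> ?A"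
      by (rule image_subsetI) (simp add: PiE_iff)
  qed
  have "finite (PiE {..<m} S)" using assms by (intro finite_PiE) auto
  then show "finite ?A" using bij_betw_finite[OF bij] by simp
  show "card ?A = (\<Prod>n<m. card (S n))"
    using bij_betw_same_card[OF bij] by (simp add: card_PiE)
qed

lemma finite_freq_box: "finite (freq_box m N)"
  unfolding freq_box_def by (rule card_finitely_supported(1)) simp

lemma card_freq_box: "card (freq_box m N) = (N + 1) ^ m"
  unfolding freq_box_def by (subst card_finitely_supported(2)) (simp_all add: nat_add_distrib)

lemma freq_box_nonempty: "freq_box m N \<noteq> {}"
proof -
  have "(\<lambda>_. 0) \<in> freq_box m N" by (simp add: freq_box_def)
  then show ?thesis by blast
qed

lemma freq_box_freqs: "\<alpha> \<in> freq_box m N \<Longrightarrow> \<alpha> \<in> freqs {..<m}"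
proof -
  assume "\<alpha> \<in> freq_box m N"
  then have "{n. \<alpha> n \<noteq> 0} \<subseteq> {..<m}" by (force simp: freq_box_def not_less[symmetric])
  then show ?thesis unfolding freqs_def using finite_subset by blast
qed

text \<open>The proportion is the product over the coordinates of \<open>(N + 1 - \<bar>\<nu> n\<bar>) / (N + 1)\<close>, the familiar
Fejer multiplier.\<close>

lemma freq_box_overlap:
  assumes "\<nu> \<in> freqs {..<m}"
  shows "(\<lambda>N. real (card {\<alpha> \<in> freq_box m N. (\<lambda>n. \<alpha> n - \<nu> n) \<in> freq_box m N}) / real (card (freq_box m N))) \<longlonglongrightarrow> 1"
proof -
  have \<nu>0: "\<nu> n = 0" if "n \<ge> m" for n using freqsD[OF assms, of n] that by auto
  have eq: "real (card {\<alpha> \<in> freq_box m N. (\<lambda>n. \<alpha> n - \<nu> n) \<in> freq_box m N}) / real (card (freq_box m N)) =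
    (\<Prod>n<m. real (nat (int N + 1 - \<bar>\<nu> n\<bar>)) / real (N + 1))" for N
  proof -
    have "{\<alpha> \<in> freq_box m N. (\<lambda>n. \<alpha> n - \<nu> n) \<in> freq_box m N} =
      {\<alpha>. (\<forall>n<m. \<alpha> n \<in> {max 0 (\<nu> n)..min (int N) (int N + \<nu> n)}) \<and> (\<forall>n\<ge>m. \<alpha> n = 0)}"
      using \<nu>0 by (auto simp: freq_box_def)
    moreover have "card {max 0 (\<nu> n)..min (int N) (int N + \<nu> n)} = nat (int N + 1 - \<bar>\<nu> n\<bar>)" for n
      by (simp add: max_def min_def abs_if algebra_simps)
    ultimately have "card {\<alpha> \<in> freq_box m N. (\<lambda>n. \<alpha> n - \<nu> n) \<in> freq_box m N} = (\<Prod>n<m. nat (int N + 1 - \<bar>\<nu> n\<bar>))"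
      by (simp only: card_finitely_supported(2) finite_atLeastAtMost_int)
    then show ?thesis by (simp only: card_freq_box prod_dividef of_nat_prod prod_constant card_lessThan of_nat_power)
  qed
  have "(\<lambda>N. real (nat (int N + 1 - \<bar>k\<bar>)) / real (N + 1)) \<longlonglongrightarrow> 1" for k :: int
  proof -
    have "(\<lambda>N. 1 - real_of_int \<bar>k\<bar> / real (N + 1)) \<longlonglongrightarrow> 1 - 0"
      by (intro tendsto_diff tendsto_const LIMSEQ_ignore_initial_segment[OF lim_const_over_n])
    moreover have "\<forall>\<^sub>F N in sequentially. 1 - real_of_int \<bar>k\<bar> / real (N + 1) = real (nat (int N + 1 - \<bar>k\<bar>)) / real (N + 1)"
      using eventually_ge_at_top[of "nat \<bar>k\<bar>"]
    proof eventually_elim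
      case (elim N)
      then have "real (nat (int N + 1 - \<bar>k\<bar>)) = real (N + 1) - real_of_int \<bar>k\<bar>" by simp
      then show ?case by (simp only:) (simp add: diff_divide_distrib del: of_nat_Suc)
    qed
    ultimately show ?thesis by (simp add: Lim_transform_eventually)
  qed
  then have "(\<lambda>N. \<Prod>n<m. real (nat (int N + 1 - \<bar>\<nu> n\<bar>)) / real (N + 1)) \<longlonglongrightarrow> (\<Prod>n<m. 1)"
    by (intro tendsto_prod)
  then show ?thesis unfolding eq by simp
qed

text \<open>The Fejer mean, written without collecting equal frequencies: \<open>\<nu>\<close> occurs as \<open>\<alpha> - \<beta>\<close> as often as the box
meets its translate by \<open>\<nu>\<close>. In this form positivity of the kernel is evident.\<close>

definition fejer :: "nat \<Rightarrow> nat \<Rightarrow> ((nat \<Rightarrow> complex) \<Rightarrow> complex) \<Rightarrow> (nat \<Rightarrow> complex) \<Rightarrow> complex" where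
  "fejer m N f z = (\<Sum>\<alpha>\<in>freq_box m N. \<Sum>\<beta>\<in>freq_box m N.
     fourier_coeff {..<m} f (\<lambda>n. \<alpha> n - \<beta> n) * monomial (\<lambda>n. \<alpha> n - \<beta> n) z) / of_nat (card (freq_box m N))"

definition fejer_kernel :: "nat \<Rightarrow> nat \<Rightarrow> (nat \<Rightarrow> complex) \<Rightarrow> (nat \<Rightarrow> complex) \<Rightarrow> real" where
  "fejer_kernel m N z w = (cmod (\<Sum>\<alpha>\<in>freq_box m N. monomial \<alpha> z * cnj (monomial \<alpha> w)))\<^sup>2 / card (freq_box m N)"

lemma freq_box_diff_freqs: "\<alpha> \<in> freq_box m N \<Longrightarrow> \<beta> \<in> freq_box m N \<Longrightarrow> (\<lambda>n. \<alpha> n - \<beta> n) \<in> freqs {..<m}"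
  by (intro freqs_diff freq_box_freqs)

text \<open>Expanding the square in the kernel as a double sum over the box turns the integral into the Fourier
coefficients at differences of box elements.\<close>

lemma fejer_conv_kernel:
  assumes f: "integrable (torus {..<m}) f" and z: "z \<in> space (torus {..<m})"
  shows "integrable (torus {..<m}) (\<lambda>w. f w * of_real (fejer_kernel m N z w))"
    and "fejer m N f z = (\<integral>w. f w * of_real (fejer_kernel m N z w) \<partial>torus {..<m})"
proof -
  let ?T = "torus {..<m}" and ?B = "freq_box m N"
  let ?d = "\<lambda>\<alpha> \<beta> n. \<alpha> n - \<beta> n :: int"
  let ?h = "\<lambda>w. \<Sum>\<alpha>\<in>?B. \<Sum>\<beta>\<in>?B. f w * cnj (monomial (?d \<alpha> \<beta>) w) * monomial (?d \<alpha> \<beta>) z / of_nat (card ?B)"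
  have eq: "?h w = f w * of_real (fejer_kernel m N z w)" if w: "w \<in> space ?T" for w
  proof -
    have "complex_of_real ((cmod (\<Sum>\<alpha>\<in>?B. monomial \<alpha> z * cnj (monomial \<alpha> w)))\<^sup>2) =
      (\<Sum>\<alpha>\<in>?B. monomial \<alpha> z * cnj (monomial \<alpha> w)) * (\<Sum>\<beta>\<in>?B. cnj (monomial \<beta> z) * monomial \<beta> w)"
      unfolding complex_norm_square by simp
    also have "\<dots> = (\<Sum>\<alpha>\<in>?B. \<Sum>\<beta>\<in>?B. monomial (?d \<alpha> \<beta>) z * cnj (monomial (?d \<alpha> \<beta>) w))"
      unfolding sum_product
      by (intro sum.cong refl) (simp add: monomial_diff[OF freq_box_freqs freq_box_freqs z] monomial_diff[OF freq_box_freqs freq_box_freqs w])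
    finally show ?thesis
      by (simp add: fejer_kernel_def sum_distrib_left sum_divide_distrib mult_ac)
  qed
  have int: "integrable ?T (\<lambda>w. f w * cnj (monomial (?d \<alpha> \<beta>) w) * monomial (?d \<alpha> \<beta>) z / of_nat (card ?B))"
    if "\<alpha> \<in> ?B" "\<beta> \<in> ?B" for \<alpha> \<beta>
    using integrable_fourier[OF f freq_box_diff_freqs[OF that]] by simp
  then have "integrable ?T ?h" by (intro Bochner_Integration.integrable_sum)
  then show "integrable ?T (\<lambda>w. f w * of_real (fejer_kernel m N z w))"
    by (subst Bochner_Integration.integrable_cong[OF refl eq[symmetric]])
  have "(\<integral>w. f w * of_real (fejer_kernel m N z w) \<partial>?T) = (\<integral>w. ?h w \<partial>?T)"
    by (rule Bochner_Integration.integral_cong[OF refl eq[symmetric]])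
  also have "\<dots> = (\<Sum>\<alpha>\<in>?B. \<Sum>\<beta>\<in>?B. \<integral>w. f w * cnj (monomial (?d \<alpha> \<beta>) w) * monomial (?d \<alpha> \<beta>) z / of_nat (card ?B) \<partial>?T)"
    using int by (simp add: Bochner_Integration.integral_sum)
  also have "\<dots> = fejer m N f z"
    by (simp add: fejer_def sum_divide_distrib fourier_coeff_def)
  finally show "fejer m N f z = (\<integral>w. f w * of_real (fejer_kernel m N z w) \<partial>?T)" ..
qed

lemma trig_poly_sum:
  assumes "\<And>i. i \<in> A \<Longrightarrow> trig_poly I (p i)"
  shows "trig_poly I (\<lambda>z. \<Sum>i\<in>A. p i z)"
  using assms by (induction A rule: infinite_finite_induct) (auto intro: trig_poly_const trig_poly.add)

lemma trig_poly_fejer: "trig_poly {..<m} (fejer m N f)"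
proof -
  have "trig_poly {..<m} (\<lambda>z. \<Sum>\<alpha>\<in>freq_box m N. \<Sum>\<beta>\<in>freq_box m N.
     fourier_coeff {..<m} f (\<lambda>n. \<alpha> n - \<beta> n) / of_nat (card (freq_box m N)) * monomial (\<lambda>n. \<alpha> n - \<beta> n) z)"
    by (intro trig_poly_sum trig_poly.monomial freq_box_diff_freqs)
  then show ?thesis by (rule trig_poly.cong) (simp add: fejer_def sum_divide_distrib)
qed

lemma integrable_fejer: "integrable (torus {..<m}) (fejer m N f)"
  by (rule trig_poly_integrable[OF trig_poly_fejer])

text \<open>The integral picks out the frequency \<open>0\<close>, which arises exactly from the pairs with \<open>\<alpha> = \<beta>\<close>, one for each
element of the box.\<close>

lemma integral_fejer: "(\<integral>z. fejer m N f z \<partial>torus {..<m}) = (\<integral>z. f z \<partial>torus {..<m})"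
proof -
  let ?T = "torus {..<m}" and ?B = "freq_box m N"
  have int: "integrable ?T (\<lambda>z. fourier_coeff {..<m} f (\<lambda>n. \<alpha> n - \<beta> n) * monomial (\<lambda>n. \<alpha> n - \<beta> n) z)"
    if "\<alpha> \<in> ?B" "\<beta> \<in> ?B" for \<alpha> \<beta>
    using integrable_monomial[OF freq_box_diff_freqs[OF that]] by simp
  have "(\<integral>z. fejer m N f z \<partial>?T) = (\<Sum>\<alpha>\<in>?B. \<Sum>\<beta>\<in>?B.
      \<integral>z. fourier_coeff {..<m} f (\<lambda>n. \<alpha> n - \<beta> n) * monomial (\<lambda>n. \<alpha> n - \<beta> n) z \<partial>?T) / of_nat (card ?B)"
  proof -
    have "(\<integral>z. (\<Sum>\<alpha>\<in>?B. \<Sum>\<beta>\<in>?B.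
        fourier_coeff {..<m} f (\<lambda>n. \<alpha> n - \<beta> n) * monomial (\<lambda>n. \<alpha> n - \<beta> n) z) \<partial>?T) =
      (\<Sum>\<alpha>\<in>?B. \<integral>z. (\<Sum>\<beta>\<in>?B.
        fourier_coeff {..<m} f (\<lambda>n. \<alpha> n - \<beta> n) * monomial (\<lambda>n. \<alpha> n - \<beta> n) z) \<partial>?T)"
      by (intro Bochner_Integration.integral_sum Bochner_Integration.integrable_sum int)
    also have "\<dots> = (\<Sum>\<alpha>\<in>?B. \<Sum>\<beta>\<in>?B.
        \<integral>z. fourier_coeff {..<m} f (\<lambda>n. \<alpha> n - \<beta> n) * monomial (\<lambda>n. \<alpha> n - \<beta> n) z \<partial>?T)"
      by (intro sum.cong refl Bochner_Integration.integral_sum int)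
    finally show ?thesis unfolding fejer_def integral_divide_zero by (rule arg_cong)
  qed
  also have "\<dots> = (\<Sum>\<alpha>\<in>?B. \<Sum>\<beta>\<in>?B. of_bool (\<alpha> = \<beta>) * fourier_coeff {..<m} f (\<lambda>_. 0)) / of_nat (card ?B)"
  proof (intro arg_cong2[where f = "(/)"] sum.cong refl)
    fix \<alpha> \<beta> assume ab: "\<alpha> \<in> ?B" "\<beta> \<in> ?B"
    have "((\<lambda>n. \<alpha> n - \<beta> n) = (\<lambda>_. 0)) \<longleftrightarrow> \<alpha> = \<beta>" by (auto simp: fun_eq_iff)
    then show "(\<integral>z. fourier_coeff {..<m} f (\<lambda>n. \<alpha> n - \<beta> n) * monomial (\<lambda>n. \<alpha> n - \<beta> n) z \<partial>?T) =
      of_bool (\<alpha> = \<beta>) * fourier_coeff {..<m} f (\<lambda>_. 0)"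
      by (simp add: integral_monomial[OF finite_lessThan freq_box_diff_freqs[OF ab]])
  qed
  also have "\<dots> = fourier_coeff {..<m} f (\<lambda>_. 0)"
    by (simp add: finite_freq_box freq_box_nonempty flip: sum_distrib_right)
  finally show ?thesis by (simp add: fourier_coeff_def monomial_0)
qed

lemma fejer_kernel_nonneg: "0 \<le> fejer_kernel m N z w"
  by (simp add: fejer_kernel_def)

text \<open>The kernel is nonnegative, so the Fejer mean of \<open>f\<close> is dominated by that of \<open>\<bar>f\<bar>\<close>, whose integral is
the integral of \<open>\<bar>f\<bar>\<close>.\<close>

lemma fejer_contraction:
  assumes f: "integrable (torus {..<m}) f"
  shows "(\<integral>z. cmod (fejer m N f z) \<partial>torus {..<m}) \<le> (\<integral>z. cmod (f z) \<partial>torus {..<m})"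
proof -
  let ?T = "torus {..<m}" and ?f = "\<lambda>z. complex_of_real (cmod (f z))"
  have f': "integrable ?T ?f" using f by simp
  have "(\<integral>z. cmod (fejer m N f z) \<partial>?T) \<le> (\<integral>z. Re (fejer m N ?f z) \<partial>?T)"
  proof (rule integral_mono)
    fix z assume z: "z \<in> space ?T"
    have "cmod (fejer m N f z) \<le> (\<integral>w. cmod (f w * of_real (fejer_kernel m N z w)) \<partial>?T)"
      unfolding fejer_conv_kernel(2)[OF f z] by (rule integral_norm_bound)
    also have "\<dots> = (\<integral>w. Re (?f w * of_real (fejer_kernel m N z w)) \<partial>?T)"
      by (simp add: norm_mult fejer_kernel_nonneg)
    also have "\<dots> = Re (fejer m N ?f z)"
      unfolding fejer_conv_kernel(2)[OF f' z]
      by (rule integral_Re[OF fejer_conv_kernel(1)[OF f' z]])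
    finally show "cmod (fejer m N f z) \<le> Re (fejer m N ?f z)" .
  qed (auto intro: integrable_fejer)
  also have "\<dots> = Re (\<integral>z. ?f z \<partial>?T)"
    using integral_Re[OF integrable_fejer] by (simp add: integral_fejer)
  finally show ?thesis by simp
qed

lemma fejer_diff:
  assumes "integrable (torus {..<m}) f" "integrable (torus {..<m}) g"
  shows "fejer m N (\<lambda>z. f z - g z) z = fejer m N f z - fejer m N g z"
  unfolding fejer_def diff_divide_distrib[symmetric] sum_subtractf[symmetric] left_diff_distrib[symmetric]
  by (intro arg_cong2[where f = "(/)"] sum.cong refl arg_cong2[where f = "(*)"] fourier_coeff_diff assms freq_box_diff_freqs)

lemma fejer_add:
  assumes "integrable (torus {..<m}) f" "integrable (torus {..<m}) g"
  shows "fejer m N (\<lambda>z. f z + g z) z = fejer m N f z + fejer m N g z"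
  unfolding fejer_def add_divide_distrib[symmetric] sum.distrib[symmetric] distrib_right[symmetric]
  by (intro arg_cong2[where f = "(/)"] sum.cong refl arg_cong2[where f = "(*)"] fourier_coeff_add assms freq_box_diff_freqs)

lemma fejer_monomial:
  assumes \<nu>: "\<nu> \<in> freqs {..<m}"
  shows "fejer m N (\<lambda>z. c * monomial \<nu> z) z =
    of_real (card {\<alpha> \<in> freq_box m N. (\<lambda>n. \<alpha> n - \<nu> n) \<in> freq_box m N} / card (freq_box m N)) * (c * monomial \<nu> z)"
proof -
  let ?B = "freq_box m N"
  have "fejer m N (\<lambda>z. c * monomial \<nu> z) z =
    (\<Sum>\<alpha>\<in>?B. \<Sum>\<beta>\<in>?B. of_bool (\<beta> = (\<lambda>n. \<alpha> n - \<nu> n)) * (c * monomial \<nu> z)) / of_nat (card ?B)"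
    unfolding fejer_def
  proof (intro arg_cong2[where f = "(/)"] sum.cong refl)
    fix \<alpha> \<beta> assume ab: "\<alpha> \<in> ?B" "\<beta> \<in> ?B"
    have "((\<lambda>n. \<alpha> n - \<beta> n) = \<nu>) \<longleftrightarrow> \<beta> = (\<lambda>n. \<alpha> n - \<nu> n)" by (auto simp: fun_eq_iff algebra_simps)
    then show "fourier_coeff {..<m} (\<lambda>z. c * monomial \<nu> z) (\<lambda>n. \<alpha> n - \<beta> n) * monomial (\<lambda>n. \<alpha> n - \<beta> n) z =
      of_bool (\<beta> = (\<lambda>n. \<alpha> n - \<nu> n)) * (c * monomial \<nu> z)"
      by (auto simp: fourier_coeff_monomial[OF finite_lessThan \<nu> freq_box_diff_freqs[OF ab]])
  qed
  also have "\<dots> = (\<Sum>\<alpha>\<in>?B. of_bool ((\<lambda>n. \<alpha> n - \<nu> n) \<in> ?B)) * (c * monomial \<nu> z) / of_nat (card ?B)"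
  proof -
    have "(\<Sum>\<beta>\<in>?B. of_bool (\<beta> = (\<lambda>n. \<alpha> n - \<nu> n)) :: complex) = of_bool ((\<lambda>n. \<alpha> n - \<nu> n) \<in> ?B)" for \<alpha>
      by (simp add: finite_freq_box)
    then show ?thesis by (simp flip: sum_distrib_right)
  qed
  also have "(\<Sum>\<alpha>\<in>?B. of_bool ((\<lambda>n. \<alpha> n - \<nu> n) \<in> ?B) :: complex) =
      of_nat (card {\<alpha> \<in> ?B. (\<lambda>n. \<alpha> n - \<nu> n) \<in> ?B})"
    by (simp add: finite_freq_box Int_def)
  finally show ?thesis by simp
qed

lemma fejer_cong:
  "(\<And>z. z \<in> space (torus {..<m}) \<Longrightarrow> f z = g z) \<Longrightarrow> fejer m N f z = fejer m N g z"
  unfolding fejer_def using fourier_coeff_cong[of "{..<m}" f g] by simp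

lemma fejer_trig_poly_tendsto:
  assumes "trig_poly {..<m} p"
  shows "(\<lambda>N. \<integral>z. cmod (fejer m N p z - p z) \<partial>torus {..<m}) \<longlonglongrightarrow> 0"
  using assms
proof induction
  case (monomial \<nu> c)
  let ?r = "\<lambda>N. real (card {\<alpha> \<in> freq_box m N. (\<lambda>n. \<alpha> n - \<nu> n) \<in> freq_box m N}) / real (card (freq_box m N))"
  have "(\<integral>z. cmod (fejer m N (\<lambda>z. c * monomial \<nu> z) z - c * monomial \<nu> z) \<partial>torus {..<m}) = cmod c * \<bar>?r N - 1\<bar>" for N
  proof -
    have "(\<integral>z. cmod (fejer m N (\<lambda>z. c * monomial \<nu> z) z - c * monomial \<nu> z) \<partial>torus {..<m}) =
       (\<integral>z. cmod c * \<bar>?r N - 1\<bar> \<partial>torus {..<m})"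
    proof (rule Bochner_Integration.integral_cong)
      fix z assume z: "z \<in> space (torus {..<m})"
      have "fejer m N (\<lambda>z. c * monomial \<nu> z) z - c * monomial \<nu> z = of_real (?r N - 1) * (c * monomial \<nu> z)"
        unfolding fejer_monomial[OF monomial] by (simp add: left_diff_distrib)
      then show "cmod (fejer m N (\<lambda>z. c * monomial \<nu> z) z - c * monomial \<nu> z) = cmod c * \<bar>?r N - 1\<bar>"
        by (simp only: norm_mult norm_of_real cmod_monomial[OF monomial z] mult_1_right mult.commute)
    qed simp
    then show ?thesis by (simp add: torus.prob_space)
  qed
  moreover have "(\<lambda>N. cmod c * \<bar>?r N - 1\<bar>) \<longlonglongrightarrow> cmod c * \<bar>1 - 1\<bar>"
    by (intro tendsto_intros freq_box_overlap monomial)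
  ultimately show ?case by simp
next
  case (add p q)
  note int = trig_poly_integrable[OF add.hyps(1)] trig_poly_integrable[OF add.hyps(2)]
  have "(\<lambda>N. (\<integral>z. cmod (fejer m N p z - p z) \<partial>torus {..<m}) + (\<integral>z. cmod (fejer m N q z - q z) \<partial>torus {..<m})) \<longlonglongrightarrow> 0 + 0"
    by (intro tendsto_add add.IH)
  then have lim: "(\<lambda>N. (\<integral>z. cmod (fejer m N p z - p z) \<partial>torus {..<m}) + (\<integral>z. cmod (fejer m N q z - q z) \<partial>torus {..<m})) \<longlonglongrightarrow> 0"
    by simp
  show ?case
  proof (rule tendsto_sandwich[OF _ _ tendsto_const lim])
    show "\<forall>\<^sub>F N in sequentially. 0 \<le> (\<integral>z. cmod (fejer m N (\<lambda>z. p z + q z) z - (p z + q z)) \<partial>torus {..<m})"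
      by simp
    show "\<forall>\<^sub>F N in sequentially. (\<integral>z. cmod (fejer m N (\<lambda>z. p z + q z) z - (p z + q z)) \<partial>torus {..<m})
       \<le> (\<integral>z. cmod (fejer m N p z - p z) \<partial>torus {..<m}) + (\<integral>z. cmod (fejer m N q z - q z) \<partial>torus {..<m})"
    proof (rule always_eventually, rule allI)
      fix N
      have "(\<integral>z. cmod (fejer m N (\<lambda>z. p z + q z) z - (p z + q z)) \<partial>torus {..<m}) \<le>
        (\<integral>z. cmod (fejer m N p z - p z) + cmod (fejer m N q z - q z) \<partial>torus {..<m})"
        unfolding fejer_add[OF int]
        using int integrable_fejer by (intro integral_mono norm_diff_triangle_ineq) auto
      also have "\<dots> = (\<integral>z. cmod (fejer m N p z - p z) \<partial>torus {..<m}) + (\<integral>z. cmod (fejer m N q z - q z) \<partial>torus {..<m})"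
        using int integrable_fejer by (intro Bochner_Integration.integral_add) auto
      finally show "(\<integral>z. cmod (fejer m N (\<lambda>z. p z + q z) z - (p z + q z)) \<partial>torus {..<m}) \<le> \<dots>" .
    qed
  qed
next
  case (cong p q)
  have "(\<integral>z. cmod (fejer m N p z - p z) \<partial>torus {..<m}) = (\<integral>z. cmod (fejer m N q z - q z) \<partial>torus {..<m})" for N
    by (rule Bochner_Integration.integral_cong) (simp_all add: cong.hyps fejer_cong[of m p q, OF cong.hyps(2)])
  with cong.IH show ?case by simp
qed

text \<open>The operators are uniformly bounded on \<open>L\<^sup>1\<close> and converge on the dense set of trigonometric polynomials.\<close>

theorem fejer_tendsto:
  assumes f: "integrable (torus {..<m}) f"
  shows "(\<lambda>N. \<integral>z. cmod (fejer m N f z - f z) \<partial>torus {..<m}) \<longlonglongrightarrow> 0"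
proof (rule LIMSEQ_I)
  fix e :: real assume "e > 0"
  \<comment> \<open>Compare \<open>f\<close> with its Fejer mean by way of \<open>p\<close> and the Fejer mean of \<open>p\<close>.\<close>
  then obtain p where p: "trig_poly {..<m} p" "(\<integral>z. cmod (f z - p z) \<partial>torus {..<m}) < e / 3"
    using integrable_imp_trig_approximable[OF f] unfolding trig_approximable_def
    by (meson divide_pos_pos zero_less_numeral)
  note int = f trig_poly_integrable[OF p(1)] integrable_fejer
  from LIMSEQ_D[OF fejer_trig_poly_tendsto[OF p(1)], of "e / 3"] \<open>e > 0\<close>
  obtain N0 where N0: "\<And>N. N \<ge> N0 \<Longrightarrow> (\<integral>z. cmod (fejer m N p z - p z) \<partial>torus {..<m}) < e / 3"
    by auto
  show "\<exists>N0. \<forall>N\<ge>N0. norm ((\<integral>z. cmod (fejer m N f z - f z) \<partial>torus {..<m}) - 0) < e"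
  proof (intro exI[of _ N0] allI impI)
    fix N assume N: "N \<ge> N0"
    have "(\<integral>z. cmod (fejer m N f z - f z) \<partial>torus {..<m}) \<le>
      (\<integral>z. cmod (fejer m N f z - fejer m N p z) \<partial>torus {..<m}) + (\<integral>z. cmod (fejer m N p z - f z) \<partial>torus {..<m})"
      using int by (intro L1_triangle)
    also have "(\<integral>z. cmod (fejer m N p z - f z) \<partial>torus {..<m}) \<le>
      (\<integral>z. cmod (fejer m N p z - p z) \<partial>torus {..<m}) + (\<integral>z. cmod (p z - f z) \<partial>torus {..<m})"
      using int by (intro L1_triangle)
    also have "(\<integral>z. cmod (fejer m N f z - fejer m N p z) \<partial>torus {..<m}) \<le> (\<integral>z. cmod (f z - p z) \<partial>torus {..<m})"
      unfolding fejer_diff[OF int(1,2), symmetric] using int by (intro fejer_contraction) auto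
    finally have "(\<integral>z. cmod (fejer m N f z - f z) \<partial>torus {..<m}) < e"
      using p(2) N0[OF N] by (simp add: norm_minus_commute)
    then show "norm ((\<integral>z. cmod (fejer m N f z - f z) \<partial>torus {..<m}) - 0) < e"
      by simp
  qed
qed

text \<open>The Fejer means of \<open>f - g\<close> depend only on its Fourier coefficients, so they vanish, and they converge to
\<open>f - g\<close>.\<close>

theorem fourier_coeff_unique:
  assumes f: "integrable (torus {..<m}) f" and g: "integrable (torus {..<m}) g"
    and eq: "\<And>\<nu>. \<nu> \<in> freqs {..<m} \<Longrightarrow> fourier_coeff {..<m} f \<nu> = fourier_coeff {..<m} g \<nu>"
  shows "AE z in torus {..<m}. f z = g z"
proof -
  let ?h = "\<lambda>z. f z - g z"
  have h: "integrable (torus {..<m}) ?h" using f g by simp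
  have "fejer m N ?h z = 0" for N z
    unfolding fejer_diff[OF f g] by (simp add: fejer_def eq freq_box_diff_freqs)
  with fejer_tendsto[OF h] have "(\<integral>z. cmod (?h z) \<partial>torus {..<m}) = 0"
    by (simp add: LIMSEQ_const_iff norm_minus_commute)
  then have "AE z in torus {..<m}. cmod (?h z) = 0"
    using h by (subst (asm) integral_nonneg_eq_0_iff_AE) auto
  then show ?thesis by eventually_elim simp
qed

section \<open>Averaging over one coordinate\<close>

interpretation circle_torus: pair_sigma_finite circle_haar "torus I" for I
  by standard

text \<open>On \<open>\<T>\<^sup>n\<^sup>+\<^sup>1\<close> this is the conditional expectation given the first \<open>n\<close> coordinates; the codomain is kept
general because it is applied both to \<open>f\<close> and to \<open>sqrt \<bar>f\<bar>\<close>.\<close>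

definition slice_mean :: "nat \<Rightarrow> ((nat \<Rightarrow> complex) \<Rightarrow> 'b) \<Rightarrow> (nat \<Rightarrow> complex) \<Rightarrow> 'b::{banach, second_countable_topology}" where
  "slice_mean n f z = (\<integral>w. f (z(n := w)) \<partial>circle_haar)"

lemma measurable_insert_coordinate:
  "(\<lambda>(w, z). z(n := w)) \<in> circle_haar \<Otimes>\<^sub>M torus {..<n} \<rightarrow>\<^sub>M torus {..<Suc n}"
proof -
  have "(\<lambda>x. (snd x)(n := fst x)) \<in> circle_haar \<Otimes>\<^sub>M PiM {..<n} (\<lambda>_. circle_haar) \<rightarrow>\<^sub>M PiM (insert n {..<n}) (\<lambda>_. circle_haar)"
    by (rule measurable_fun_upd[where J = "{..<n}"]) auto
  then show ?thesis
    by (simp add: torus_def lessThan_Suc split_beta)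
qed

lemma distr_insert_coordinate:
  "distr (circle_haar \<Otimes>\<^sub>M torus {..<n}) (torus {..<Suc n}) (\<lambda>(w, z). z(n := w)) = torus {..<Suc n}"
  unfolding torus_def lessThan_Suc by (rule distr_pair_PiM_eq_PiM) (rule prob_space_circle_haar)+

lemma
  fixes f :: "(nat \<Rightarrow> complex) \<Rightarrow> 'b::{banach, second_countable_topology}"
  assumes f: "integrable (torus {..<Suc n}) f"
  shows AE_integrable_slice: "AE z in torus {..<n}. integrable circle_haar (\<lambda>w. f (z(n := w)))"
    and integrable_slice_mean: "integrable (torus {..<n}) (slice_mean n f)"
    and integral_slice_mean: "(\<integral>z. slice_mean n f z \<partial>torus {..<n}) = (\<integral>z. f z \<partial>torus {..<Suc n})"
proof -
  have "integrable (circle_haar \<Otimes>\<^sub>M torus {..<n}) (\<lambda>x. f ((\<lambda>(w, z). z(n := w)) x))"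
    by (rule integrable_distr[OF measurable_insert_coordinate]) (simp add: distr_insert_coordinate f)
  then have int: "integrable (circle_haar \<Otimes>\<^sub>M torus {..<n}) (case_prod (\<lambda>w z. f (z(n := w))))"
    by (simp add: case_prod_beta')
  show "AE z in torus {..<n}. integrable circle_haar (\<lambda>w. f (z(n := w)))"
    by (rule circle_torus.AE_integrable_snd[OF int])
  show "integrable (torus {..<n}) (slice_mean n f)"
    unfolding slice_mean_def by (rule circle_torus.integrable_snd[OF int])
  have "(\<integral>z. slice_mean n f z \<partial>torus {..<n}) =
    (\<integral>x. f ((\<lambda>(w, z). z(n := w)) x) \<partial>(circle_haar \<Otimes>\<^sub>M torus {..<n}))"
    unfolding slice_mean_def circle_torus.integral_snd[OF int] by (simp add: case_prod_beta')
  also have "\<dots> = (\<integral>z. f z \<partial>distr (circle_haar \<Otimes>\<^sub>M torus {..<n}) (torus {..<Suc n}) (\<lambda>(w, z). z(n := w)))"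
    by (rule integral_distr[symmetric, OF measurable_insert_coordinate]) (use f in auto)
  finally show "(\<integral>z. slice_mean n f z \<partial>torus {..<n}) = (\<integral>z. f z \<partial>torus {..<Suc n})"
    by (simp only: distr_insert_coordinate)
qed

lemma monomial_insert:
  assumes "\<nu> \<in> freqs {..<Suc n}"
  shows "monomial \<nu> (z(n := w)) = monomial (\<nu>(n := 0)) z * w powi \<nu> n"
proof -
  have supp: "{k. \<nu> k \<noteq> 0} \<subseteq> {..<Suc n}" using assms by (simp add: freqs_def)
  then have supp': "{k. (\<nu>(n := 0)) k \<noteq> 0} \<subseteq> {..<n}" by (auto simp: less_Suc_eq)
  show ?thesis
    unfolding monomial_superset[OF finite_lessThan supp] monomial_superset[OF finite_lessThan supp']
    by (simp add: lessThan_Suc mult.commute)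
qed

text \<open>For a frequency that does not involve the last coordinate the character is constant on each slice and
can be taken out of the inner integral.\<close>

lemma fourier_coeff_slice_mean:
  assumes f: "integrable (torus {..<Suc n}) f" and \<nu>: "\<nu> \<in> freqs {..<n}"
  shows "fourier_coeff {..<n} (slice_mean n f) \<nu> = fourier_coeff {..<Suc n} f \<nu>"
proof -
  have \<nu>': "\<nu> \<in> freqs {..<Suc n}" using \<nu> freqs_mono[of "{..<n}" "{..<Suc n}"] by auto
  have "\<nu> n = 0" using freqsD[OF \<nu>, of n] by auto
  then have m: "monomial \<nu> (z(n := w)) = monomial \<nu> z" for z w
    by (simp add: monomial_insert[OF \<nu>'] fun_upd_idem)
  have "fourier_coeff {..<Suc n} f \<nu> = (\<integral>z. slice_mean n (\<lambda>z. f z * cnj (monomial \<nu> z)) z \<partial>torus {..<n})"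
    unfolding fourier_coeff_def by (rule integral_slice_mean[symmetric, OF integrable_fourier[OF f \<nu>']])
  also have "\<dots> = fourier_coeff {..<n} (slice_mean n f) \<nu>"
    unfolding fourier_coeff_def slice_mean_def m by simp
  finally show ?thesis ..
qed

section \<open>Square roots of moduli\<close>

lemma sqrt_diff_le:
  fixes a b :: real
  assumes "0 \<le> a" "0 \<le> b"
  shows "\<bar>sqrt a - sqrt b\<bar> \<le> sqrt \<bar>a - b\<bar>"
proof (cases "a \<le> b")
  case True
  then show ?thesis using sqrt_add_le_add_sqrt[of a "b - a"] assms by (simp add: abs_if)
next
  case False
  then show ?thesis using sqrt_add_le_add_sqrt[of b "a - b"] assms by (simp add: abs_if)
qed

lemma sqrt_norm_diff_le: "\<bar>sqrt (norm x) - sqrt (norm y)\<bar> \<le> sqrt (norm (x - y))"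
  by (rule order_trans[OF sqrt_diff_le]) (auto simp: norm_triangle_ineq3)

lemma (in finite_measure) integrable_sqrt_norm:
  fixes f :: "'a \<Rightarrow> 'b::{banach, second_countable_topology}"
  assumes "integrable M f"
  shows "integrable M (\<lambda>x. sqrt (norm (f x)))"
proof (rule Bochner_Integration.integrable_bound[of _ "\<lambda>x. 1 + norm (f x)"])
  have "sqrt t \<le> 1 + t" if "t \<ge> 0" for t
    by (rule real_le_lsqrt) (use that in \<open>auto simp: power2_eq_square algebra_simps\<close>)
  then show "AE x in M. norm (sqrt (norm (f x))) \<le> norm (1 + norm (f x))"
    by simp
qed (use assms in auto)

lemma (in prob_space) expectation_sqrt_le:
  fixes f :: "'a \<Rightarrow> 'b::{banach, second_countable_topology}"
  assumes "integrable M f"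
  shows "(\<integral>x. sqrt (norm (f x)) \<partial>M) \<le> sqrt (\<integral>x. norm (f x) \<partial>M)"
proof (rule real_le_rsqrt)
  have "0 \<le> variance (\<lambda>x. sqrt (norm (f x)))" by (rule variance_positive)
  also have "\<dots> = (\<integral>x. (sqrt (norm (f x)))\<^sup>2 \<partial>M) - (\<integral>x. sqrt (norm (f x)) \<partial>M)\<^sup>2"
    using assms by (intro variance_eq integrable_sqrt_norm) auto
  finally show "(\<integral>x. sqrt (norm (f x)) \<partial>M)\<^sup>2 \<le> (\<integral>x. norm (f x) \<partial>M)" by simp
qed

lemma tendsto_integral_L1:
  fixes u :: "nat \<Rightarrow> 'a \<Rightarrow> 'b::{banach, second_countable_topology}"
  assumes u: "\<And>N. integrable M (u N)" and f: "integrable M f"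
    and lim: "(\<lambda>N. \<integral>x. norm (u N x - f x) \<partial>M) \<longlonglongrightarrow> 0"
  shows "(\<lambda>N. \<integral>x. u N x \<partial>M) \<longlonglongrightarrow> (\<integral>x. f x \<partial>M)"
proof (rule LIM_zero_cancel, rule Lim_null_comparison[OF always_eventually lim], rule allI)
  fix N
  have "norm ((\<integral>x. u N x \<partial>M) - (\<integral>x. f x \<partial>M)) = norm (\<integral>x. u N x - f x \<partial>M)"
    using u f by simp
  also have "\<dots> \<le> (\<integral>x. norm (u N x - f x) \<partial>M)" by (rule integral_norm_bound)
  finally show "norm ((\<integral>x. u N x \<partial>M) - (\<integral>x. f x \<partial>M)) \<le> (\<integral>x. norm (u N x - f x) \<partial>M)" .
qed

text \<open>The map \<open>f \<mapsto> sqrt \<bar>f\<bar>\<close> is uniformly continuous from \<open>L\<^sup>1\<close> to \<open>L\<^sup>1\<close> of a probability space, by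
\<open>\<bar>sqrt a - sqrt b\<bar> \<le> sqrt \<bar>a - b\<bar>\<close> and Jensen's inequality.\<close>

lemma (in prob_space) tendsto_integral_sqrt_L1:
  fixes u :: "nat \<Rightarrow> 'a \<Rightarrow> 'b::{banach, second_countable_topology}"
  assumes u: "\<And>N. integrable M (u N)" and f: "integrable M f"
    and lim: "(\<lambda>N. \<integral>x. norm (u N x - f x) \<partial>M) \<longlonglongrightarrow> 0"
  shows "(\<lambda>N. \<integral>x. sqrt (norm (u N x)) \<partial>M) \<longlonglongrightarrow> (\<integral>x. sqrt (norm (f x)) \<partial>M)"
proof (rule tendsto_integral_L1)
  have lim': "(\<lambda>N. sqrt (\<integral>x. norm (u N x - f x) \<partial>M)) \<longlonglongrightarrow> 0"
    using tendsto_real_sqrt[OF lim] by simp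
  show "(\<lambda>N. \<integral>x. norm (sqrt (norm (u N x)) - sqrt (norm (f x))) \<partial>M) \<longlonglongrightarrow> 0"
  proof (rule tendsto_sandwich[OF always_eventually always_eventually tendsto_const lim'], safe)
    fix N
    have "(\<integral>x. norm (sqrt (norm (u N x)) - sqrt (norm (f x))) \<partial>M) \<le> (\<integral>x. sqrt (norm (u N x - f x)) \<partial>M)"
      using u f by (intro integral_mono integrable_sqrt_norm)
        (auto intro!: integrable_sqrt_norm sqrt_norm_diff_le Bochner_Integration.integrable_diff)
    also have "\<dots> \<le> sqrt (\<integral>x. norm (u N x - f x) \<partial>M)"
      using u f by (intro expectation_sqrt_le) auto
    finally show "(\<integral>x. norm (sqrt (norm (u N x)) - sqrt (norm (f x))) \<partial>M) \<le> sqrt (\<integral>x. norm (u N x - f x) \<partial>M)" .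
  qed simp
qed (auto intro: integrable_sqrt_norm u f)

lemma circle_poly_sum:
  assumes "finite A" "\<And>i. i \<in> A \<Longrightarrow> \<exists>p. \<forall>w\<in>W. f i w = poly p w"
  shows "\<exists>p :: complex poly. \<forall>w\<in>W. (\<Sum>i\<in>A. f i w) = poly p w"
proof -
  from assms(2) obtain p where "\<And>i w. i \<in> A \<Longrightarrow> w \<in> W \<Longrightarrow> f i w = poly (p i) w" by metis
  then show ?thesis by (intro exI[of _ "\<Sum>i\<in>A. p i"]) (simp add: poly_sum)
qed

text \<open>Membership in \<open>H\<^sup>1\<close> removes every negative power of the last variable.\<close>

lemma fejer_slice_poly:
  assumes f: "f \<in> H1 {..<Suc n}"
  shows "\<exists>p. \<forall>w\<in>sphere 0 1. fejer (Suc n) N f (z(n := w)) = poly p w"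
proof -
  let ?B = "freq_box (Suc n) N"
  have "\<exists>p. \<forall>w\<in>sphere 0 1. fourier_coeff {..<Suc n} f (\<lambda>k. \<alpha> k - \<beta> k) *
      monomial (\<lambda>k. \<alpha> k - \<beta> k) (z(n := w)) = poly p w" if ab: "\<alpha> \<in> ?B" "\<beta> \<in> ?B" for \<alpha> \<beta>
  proof (cases "(\<lambda>k. \<alpha> k - \<beta> k) \<in> nonneg_freqs {..<Suc n}")
    case True
    then have "\<alpha> n - \<beta> n \<ge> 0" by (simp add: nonneg_freqs_def)
    then have "w powi (\<alpha> n - \<beta> n) = w ^ nat (\<alpha> n - \<beta> n)" for w :: complex
      by (simp add: power_int_def)
    then show ?thesis
      by (intro exI[of _ "monom (fourier_coeff {..<Suc n} f (\<lambda>k. \<alpha> k - \<beta> k) *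
            monomial ((\<lambda>k. \<alpha> k - \<beta> k)(n := 0)) z) (nat (\<alpha> n - \<beta> n))"])
         (simp add: monomial_insert[OF freq_box_diff_freqs[OF ab]] poly_monom)
  next
    case False
    then have "fourier_coeff {..<Suc n} f (\<lambda>k. \<alpha> k - \<beta> k) = 0"
      using f freq_box_diff_freqs[OF ab] by (simp add: H1_def)
    then show ?thesis by (intro exI[of _ 0]) simp
  qed
  then have "\<exists>p. \<forall>w\<in>sphere 0 1. (\<Sum>\<alpha>\<in>?B. \<Sum>\<beta>\<in>?B. fourier_coeff {..<Suc n} f (\<lambda>k. \<alpha> k - \<beta> k) *
      monomial (\<lambda>k. \<alpha> k - \<beta> k) (z(n := w))) = poly p w"
    by (intro circle_poly_sum finite_freq_box)
  then obtain p where "\<And>w. w \<in> sphere 0 1 \<Longrightarrow> (\<Sum>\<alpha>\<in>?B. \<Sum>\<beta>\<in>?B. fourier_coeff {..<Suc n} f (\<lambda>k. \<alpha> k - \<beta> k) *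
      monomial (\<lambda>k. \<alpha> k - \<beta> k) (z(n := w))) = poly p w" by auto
  then show ?thesis
    by (intro exI[of _ "smult (1 / of_nat (card ?B)) p"]) (simp add: fejer_def)
qed

lemma circle_integral_cong:
  "(\<And>w. w \<in> sphere 0 1 \<Longrightarrow> f w = g w) \<Longrightarrow> (\<integral>w. f w \<partial>circle_haar) = (\<integral>w. g w \<partial>circle_haar)"
  by (rule Bochner_Integration.integral_cong) (auto simp: space_circle_haar)

text \<open>The inequality holds for the slices of the Fejer means, which are polynomials. After passage to a
subsequence the Fejer means converge in \<open>L\<^sup>1\<close> of the circle on almost every slice, and both sides are
continuous for this convergence.\<close>

theorem sqrt_submean_slice:
  assumes f: "f \<in> H1 {..<Suc n}"
  shows "AE z in torus {..<n}. sqrt (cmod (slice_mean n f z)) \<le> slice_mean n (\<lambda>z. sqrt (cmod (f z))) z"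
proof -
  let ?P = "\<lambda>N. fejer (Suc n) N f"
  let ?D = "\<lambda>N. slice_mean n (\<lambda>z. cmod (?P N z - f z))"
  have int: "integrable (torus {..<Suc n}) f" using f by (simp add: H1_def)
  have intD: "integrable (torus {..<Suc n}) (\<lambda>z. cmod (?P N z - f z))" for N
    using int integrable_fejer by simp
  have D0: "0 \<le> ?D N z" for N z by (simp add: slice_mean_def)
  have "(\<lambda>N. \<integral>z. norm (?D N z) \<partial>torus {..<n}) \<longlonglongrightarrow> 0"
    using fejer_tendsto[OF int] by (simp add: D0 integral_slice_mean[OF intD])
  from tendsto_L1_AE_subseq[OF integrable_slice_mean[OF intD] this]
  obtain r where r: "strict_mono r" "AE z in torus {..<n}. (\<lambda>N. ?D (r N) z) \<longlonglongrightarrow> 0" by blast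
  from r(2) AE_integrable_slice[OF int] AE_space show ?thesis
  proof eventually_elim
    case (elim z)
    let ?u = "\<lambda>N w. ?P (r N) (z(n := w))" and ?f = "\<lambda>w. f (z(n := w))"
    have "\<forall>N. \<exists>p. \<forall>w\<in>sphere 0 1. ?u N w = poly p w"
      by (intro allI fejer_slice_poly[OF f])
    from choice[OF this] obtain p where p': "\<forall>N. \<forall>w\<in>sphere 0 1. ?u N w = poly (p N) w" by blast
    have p: "?u N w = poly (p N) w" if "w \<in> sphere 0 1" for N w
      by (rule p'[rule_format, OF that])
    have "integrable circle_haar (\<lambda>w. poly (p N) w)" for N
      by (intro integrable_circle_haar continuous_intros)
    then have u: "integrable circle_haar (?u N)" for N
      by (subst Bochner_Integration.integrable_cong[OF refl, of _ _ "\<lambda>w. poly (p N) w"])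
         (auto simp: space_circle_haar p)
    have lim: "(\<lambda>N. \<integral>w. norm (?u N w - ?f w) \<partial>circle_haar) \<longlonglongrightarrow> 0"
      using elim(1) by (simp add: slice_mean_def)
    have "sqrt (cmod (\<integral>w. ?u N w \<partial>circle_haar)) \<le> (\<integral>w. sqrt (cmod (?u N w)) \<partial>circle_haar)" for N
    proof -
      have "(\<integral>w. ?u N w \<partial>circle_haar) = (\<integral>w. poly (p N) w \<partial>circle_haar)"
        "(\<integral>w. sqrt (cmod (?u N w)) \<partial>circle_haar) = (\<integral>w. sqrt (cmod (poly (p N) w)) \<partial>circle_haar)"
        by (rule circle_integral_cong, simp add: p)+
      then show ?thesis using sqrt_submean_poly[of "p N"] by simp
    qed
    then have "sqrt (cmod (\<integral>w. ?f w \<partial>circle_haar)) \<le> (\<integral>w. sqrt (cmod (?f w)) \<partial>circle_haar)"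
      by (intro LIMSEQ_le[OF tendsto_real_sqrt[OF tendsto_norm[OF tendsto_integral_L1[OF u elim(2) lim]]]
              circle.tendsto_integral_sqrt_L1[OF u elim(2) lim]]) auto
    then show ?case by (simp add: slice_mean_def)
  qed
qed

section \<open>Convergence in the mean\<close>

text \<open>The limit of an almost everywhere convergent subsequence; Fatou's lemma, applied to the differences
with a fixed member of the sequence, gives convergence in \<open>L\<^sup>1\<close>.\<close>

lemma L1_complete:
  fixes s :: "nat \<Rightarrow> 'a \<Rightarrow> 'b::{banach, second_countable_topology}"
  assumes int: "\<And>n. integrable M (s n)"
    and cauchy: "\<And>e. e > 0 \<Longrightarrow> \<exists>N. \<forall>i\<ge>N. \<forall>j\<ge>N. (\<integral>x. norm (s i x - s j x) \<partial>M) < e"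
  obtains f where "integrable M f" "(\<lambda>n. \<integral>x. norm (s n x - f x) \<partial>M) \<longlonglongrightarrow> 0"
proof -
  note [measurable] = borel_measurable_integrable[OF int]
  obtain r where r: "strict_mono r" "AE x in M. Cauchy (\<lambda>i. s (r i) x)"
    using cauchy_L1_AE_cauchy_subseq[OF int cauchy] by blast
  define f where "f x = lim (\<lambda>i. s (r i) x)" for x
  have [measurable]: "f \<in> borel_measurable M"
    unfolding f_def by measurable
  have lim: "AE x in M. (\<lambda>i. s (r i) x) \<longlonglongrightarrow> f x"
    using r(2) by eventually_elim (simp add: f_def Cauchy_convergent_iff convergent_LIMSEQ_iff)
  have bound: "\<exists>N. \<forall>n\<ge>N. (\<integral>\<^sup>+x. norm (s n x - f x) \<partial>M) \<le> ennreal e" if e: "e > 0" for e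
  proof -
    obtain N where N: "\<And>i j. i \<ge> N \<Longrightarrow> j \<ge> N \<Longrightarrow> (\<integral>x. norm (s i x - s j x) \<partial>M) < e"
      using cauchy[OF e] by blast
    have "(\<integral>\<^sup>+x. norm (s n x - f x) \<partial>M) \<le> ennreal e" if n: "n \<ge> N" for n
    proof -
      have "(\<integral>\<^sup>+x. norm (s n x - f x) \<partial>M) = (\<integral>\<^sup>+x. liminf (\<lambda>i. ennreal (norm (s n x - s (r i) x))) \<partial>M)"
      proof (rule nn_integral_cong_AE)
        show "AE x in M. ennreal (norm (s n x - f x)) = liminf (\<lambda>i. ennreal (norm (s n x - s (r i) x)))"
          using lim
        proof eventually_elim
          case (elim x)
          have "(\<lambda>i. ennreal (norm (s n x - s (r i) x))) \<longlonglongrightarrow> ennreal (norm (s n x - f x))"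
            by (intro tendsto_ennrealI tendsto_norm tendsto_diff tendsto_const elim)
          then show ?case by (rule lim_imp_Liminf[OF sequentially_bot, symmetric])
        qed
      qed
      also have "\<dots> \<le> liminf (\<lambda>i. \<integral>\<^sup>+x. norm (s n x - s (r i) x) \<partial>M)"
        by (rule nn_integral_liminf) measurable
      also have "\<dots> \<le> liminf (\<lambda>i. ennreal e)"
      proof (rule Liminf_mono)
        show "\<forall>\<^sub>F i in sequentially. (\<integral>\<^sup>+x. norm (s n x - s (r i) x) \<partial>M) \<le> ennreal e"
          using eventually_ge_at_top[of N]
        proof eventually_elim
          case (elim i)
          then have "r i \<ge> N" using seq_suble[OF r(1), of i] by simp
          from N[OF n this] show ?case
            using int by (subst nn_integral_eq_integral) (auto intro!: ennreal_leI)
        qed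
      qed
      finally show ?thesis by (simp add: Liminf_const)
    qed
    then show ?thesis by blast
  qed
  obtain n0 where n0: "(\<integral>\<^sup>+x. norm (s n0 x - f x) \<partial>M) \<le> ennreal 1"
    using bound[of 1] by auto
  have "integrable M (\<lambda>x. s n0 x - f x)"
    by (rule integrableI_bounded) (use n0 in \<open>auto simp: le_less_trans\<close>)
  from Bochner_Integration.integrable_diff[OF int[of n0] this] have f: "integrable M f" by simp
  moreover have "(\<lambda>n. \<integral>x. norm (s n x - f x) \<partial>M) \<longlonglongrightarrow> 0"
  proof (rule LIMSEQ_I)
    fix e :: real assume "e > 0"
    then obtain N where N: "\<And>n. n \<ge> N \<Longrightarrow> (\<integral>\<^sup>+x. norm (s n x - f x) \<partial>M) \<le> ennreal (e / 2)"
      using bound[of "e / 2"] by auto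
    have "(\<integral>x. norm (s n x - f x) \<partial>M) \<le> e / 2" if "n \<ge> N" for n
    proof -
      have "ennreal (\<integral>x. norm (s n x - f x) \<partial>M) \<le> ennreal (e / 2)"
        using N[OF that] int f by (subst (asm) nn_integral_eq_integral) auto
      then show ?thesis using \<open>e > 0\<close> by simp
    qed
    moreover have "e / 2 < e" using \<open>e > 0\<close> by simp
    ultimately have "norm ((\<integral>x. norm (s n x - f x) \<partial>M) - 0) < e" if "n \<ge> N" for n
      using le_less_trans that by fastforce
    then show "\<exists>N. \<forall>n\<ge>N. norm ((\<integral>x. norm (s n x - f x) \<partial>M) - 0) < e" by blast
  qed
  ultimately show ?thesis using that by blast
qed

lemma Cauchy_Schwarz_integral:
  fixes f g :: "'a \<Rightarrow> real"
  assumes [measurable]: "f \<in> borel_measurable M" "g \<in> borel_measurable M"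
    and f: "integrable M (\<lambda>x. (f x)\<^sup>2)" and g: "integrable M (\<lambda>x. (g x)\<^sup>2)"
  shows integrable_mult_square: "integrable M (\<lambda>x. f x * g x)"
    and Cauchy_Schwarz_integral_le: "(\<integral>x. f x * g x \<partial>M) \<le> sqrt (\<integral>x. (f x)\<^sup>2 \<partial>M) * sqrt (\<integral>x. (g x)\<^sup>2 \<partial>M)"
proof -
  have le: "\<bar>a * b\<bar> \<le> a\<^sup>2 + b\<^sup>2" for a b :: real
  proof -
    have "2 * \<bar>a * b\<bar> \<le> a\<^sup>2 + b\<^sup>2"
      using sum_squares_bound[of "\<bar>a\<bar>" "\<bar>b\<bar>"] by (simp add: abs_mult)
    then show ?thesis using abs_ge_zero[of "a * b"] by linarith
  qed
  show int: "integrable M (\<lambda>x. f x * g x)"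
    by (rule Bochner_Integration.integrable_bound[OF Bochner_Integration.integrable_add[OF f g]])
       (use le in auto)
  have "(\<integral>x. f x * g x \<partial>M) \<le> (\<integral>x. \<bar>f x\<bar> * \<bar>g x\<bar> \<partial>M)"
    using int by (intro integral_mono) (auto simp flip: abs_mult)
  also have "\<dots> \<le> sqrt ((\<integral>x. (f x)\<^sup>2 \<partial>M) * (\<integral>x. (g x)\<^sup>2 \<partial>M))"
  proof (rule real_le_rsqrt)
    have "(\<integral>\<^sup>+x. ennreal \<bar>f x\<bar> * ennreal \<bar>g x\<bar> \<partial>M)\<^sup>2 \<le>
      (\<integral>\<^sup>+x. (ennreal \<bar>f x\<bar>)\<^sup>2 \<partial>M) * (\<integral>\<^sup>+x. (ennreal \<bar>g x\<bar>)\<^sup>2 \<partial>M)"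
      by (rule Cauchy_Schwarz_nn_integral) measurable
    moreover have "(\<integral>\<^sup>+x. ennreal \<bar>f x\<bar> * ennreal \<bar>g x\<bar> \<partial>M) = ennreal (\<integral>x. \<bar>f x\<bar> * \<bar>g x\<bar> \<partial>M)"
    proof -
      have "integrable M (\<lambda>x. \<bar>f x\<bar> * \<bar>g x\<bar>)" using int by (simp flip: abs_mult)
      then show ?thesis by (subst nn_integral_eq_integral[symmetric]) (simp_all add: ennreal_mult)
    qed
    moreover have "(\<integral>\<^sup>+x. (ennreal \<bar>f x\<bar>)\<^sup>2 \<partial>M) = ennreal (\<integral>x. (f x)\<^sup>2 \<partial>M)"
      using f by (subst nn_integral_eq_integral[symmetric]) (auto simp: ennreal_power)
    moreover have "(\<integral>\<^sup>+x. (ennreal \<bar>g x\<bar>)\<^sup>2 \<partial>M) = ennreal (\<integral>x. (g x)\<^sup>2 \<partial>M)"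
      using g by (subst nn_integral_eq_integral[symmetric]) (auto simp: ennreal_power)
    ultimately show "(\<integral>x. \<bar>f x\<bar> * \<bar>g x\<bar> \<partial>M)\<^sup>2 \<le> (\<integral>x. (f x)\<^sup>2 \<partial>M) * (\<integral>x. (g x)\<^sup>2 \<partial>M)"
      by (simp add: ennreal_power flip: ennreal_mult)
  qed
  finally show "(\<integral>x. f x * g x \<partial>M) \<le> sqrt (\<integral>x. (f x)\<^sup>2 \<partial>M) * sqrt (\<integral>x. (g x)\<^sup>2 \<partial>M)"
    by (simp add: real_sqrt_mult)
qed

text \<open>The quantitative core of the argument. In the application \<open>F\<close> and \<open>G\<close> are a later and an earlier member
of an \<open>L\<^sup>1\<close> martingale whose moduli have a submartingale as square roots; the bound tends to \<open>0\<close> with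
the difference \<open>\<delta>\<close> of the norms. Factor \<open>F = u h\<close> and \<open>G = v k\<close> with
\<open>h = \<bar>u\<bar> = sqrt \<bar>F\<bar>\<close> and \<open>k = \<bar>v\<bar> = sqrt \<bar>G\<bar>\<close>. The first hypothesis makes \<open>h\<close> and \<open>k\<close> close in \<open>L\<^sup>2\<close>,
the second one then does the same for \<open>u\<close> and \<open>v\<close>, and
\<open>u h - v k = u (h - k) + (u - v) k\<close>.\<close>

lemma L1_distance_via_square_roots:
  fixes F G :: "'a \<Rightarrow> complex"
  assumes F: "integrable M F" and G: "integrable M G"
    and sub: "(\<integral>x. cmod (G x) \<partial>M) \<le> (\<integral>x. sqrt (cmod (F x)) * sqrt (cmod (G x)) \<partial>M)"
    and mart: "(\<integral>x. F x * cnj (sgn (G x)) \<partial>M) = of_real (\<integral>x. cmod (G x) \<partial>M)"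
  defines "S \<equiv> \<integral>x. cmod (F x) \<partial>M"
    and "\<delta> \<equiv> (\<integral>x. cmod (F x) \<partial>M) - (\<integral>x. cmod (G x) \<partial>M)"
  shows "0 \<le> \<delta>"
    and "(\<integral>x. cmod (F x - G x) \<partial>M) \<le> sqrt S * sqrt \<delta> + sqrt S * sqrt (\<delta> + 2 * (sqrt S * sqrt \<delta>))"
proof -
  define h where "h x = sqrt (cmod (F x))" for x
  define k where "k x = sqrt (cmod (G x))" for x
  \<comment> \<open>The quotients are \<open>0\<close> where \<open>F\<close> or \<open>G\<close> vanishes, by the convention \<open>x / 0 = 0\<close>.\<close>
  define u where "u x = F x / of_real (h x)" for x
  define v where "v x = G x / of_real (k x)" for x
  have hk0: "0 \<le> h x" "0 \<le> k x" for x by (simp_all add: h_def k_def)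
  have h2: "(h x)\<^sup>2 = cmod (F x)" and k2: "(k x)\<^sup>2 = cmod (G x)" for x by (simp_all add: h_def k_def)
  have uh: "u x * of_real (h x) = F x" and vk: "v x * of_real (k x) = G x" for x
    by (simp_all add: u_def v_def h_def k_def)
  have cu: "cmod (u x) = h x" and cv: "cmod (v x) = k x" for x
    by (simp_all add: u_def v_def h_def k_def norm_divide real_div_sqrt)
  have vsgn: "v x = sgn (G x) * of_real (k x)" for x
  proof -
    have "sgn (G x) * of_real (k x) * of_real (k x) = G x"
      using k2[of x] by (simp add: sgn_eq mult.assoc power2_eq_square flip: of_real_mult)
    then have "v x * of_real (k x) = sgn (G x) * of_real (k x) * of_real (k x)" using vk by simp
    then show ?thesis
    proof (cases "k x = 0")
      case False
      then have "complex_of_real (k x) \<noteq> 0" by simp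
      then show ?thesis by (rule mult_right_cancel[THEN iffD1]) fact
    qed (simp add: v_def)
  qed
  note [measurable] = borel_measurable_integrable[OF F] borel_measurable_integrable[OF G]
  have [measurable]: "h \<in> borel_measurable M" "k \<in> borel_measurable M" "u \<in> borel_measurable M" "v \<in> borel_measurable M"
    unfolding h_def[abs_def] k_def[abs_def] u_def[abs_def] v_def[abs_def] by measurable
  have ih: "integrable M (\<lambda>x. (h x)\<^sup>2)" and ik: "integrable M (\<lambda>x. (k x)\<^sup>2)"
    using F G by (simp_all add: h2 k2)
  have ihk: "integrable M (\<lambda>x. h x * k x)" by (rule Cauchy_Schwarz_integral(1)[OF _ _ ih ik]) measurable
  define d where "d x = \<bar>h x - k x\<bar>" for x
  define e where "e x = cmod (u x - v x)" for x
  have [measurable]: "d \<in> borel_measurable M" "e \<in> borel_measurable M"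
    unfolding d_def[abs_def] e_def[abs_def] by measurable
  have Sh: "(\<integral>x. (h x)\<^sup>2 \<partial>M) = S" by (simp add: h2 S_def)
  have Sk: "(\<integral>x. (k x)\<^sup>2 \<partial>M) = S - \<delta>" by (simp add: k2 S_def \<delta>_def)
  have sub': "S - \<delta> \<le> (\<integral>x. h x * k x \<partial>M)" using sub by (simp add: h_def k_def S_def \<delta>_def)
  have d2: "(d x)\<^sup>2 = (h x)\<^sup>2 + (k x)\<^sup>2 - 2 * (h x * k x)" for x
    by (simp add: d_def power2_diff)
  then have id: "integrable M (\<lambda>x. (d x)\<^sup>2)" using ih ik ihk by simp
  have "(\<integral>x. (d x)\<^sup>2 \<partial>M) = S + (S - \<delta>) - 2 * (\<integral>x. h x * k x \<partial>M)"
    unfolding d2 using ih ik ihk by (simp add: Sh Sk)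
  then have D: "(\<integral>x. (d x)\<^sup>2 \<partial>M) \<le> \<delta>" using sub' by simp
  moreover have "0 \<le> (\<integral>x. (d x)\<^sup>2 \<partial>M)" by simp
  ultimately show \<delta>0: "0 \<le> \<delta>" by linarith
  have S0: "0 \<le> S" by (simp add: S_def)
  have ihd: "integrable M (\<lambda>x. h x * d x)" by (rule Cauchy_Schwarz_integral(1)[OF _ _ ih id]) measurable
  have "(\<integral>x. h x * d x \<partial>M) \<le> sqrt (\<integral>x. (h x)\<^sup>2 \<partial>M) * sqrt (\<integral>x. (d x)\<^sup>2 \<partial>M)"
    by (rule Cauchy_Schwarz_integral(2)[OF _ _ ih id]) measurable
  also have "\<dots> \<le> sqrt S * sqrt \<delta>"
    using D S0 by (intro mult_mono) (auto simp: Sh)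
  finally have hd: "(\<integral>x. h x * d x \<partial>M) \<le> sqrt S * sqrt \<delta>" .
  have iFs: "integrable M (\<lambda>x. F x * cnj (sgn (G x)))"
  proof (rule integrable_mult_bounded[OF F])
    have "(\<lambda>x. sgn (G x)) \<in> borel_measurable M" unfolding sgn_div_norm by measurable
    then show "(\<lambda>x. cnj (sgn (G x))) \<in> borel_measurable M"
      by (rule borel_measurable_continuous_on[rotated]) (intro continuous_intros)
    show "norm (cnj (sgn (G x))) \<le> 1" for x
      by (simp only: complex_mod_cnj norm_sgn) simp
  qed
  define q where "q x = F x * cnj (sgn (G x))" for x
  have iq: "integrable M q" using iFs by (simp only: q_def[abs_def])
  \<comment> \<open>Since \<open>u * cnj v = u * k * cnj (sgn G)\<close>, replacing \<open>k\<close> by \<open>h\<close> gives \<open>q\<close>, whose integral is known, with an error of at most \<open>h * d\<close>.\<close>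
  have ee: "(e x)\<^sup>2 \<le> (h x)\<^sup>2 + (k x)\<^sup>2 - 2 * Re (q x) + 2 * (h x * d x)" for x
  proof -
    have "(e x)\<^sup>2 = (cmod (u x))\<^sup>2 + (cmod (v x))\<^sup>2 - 2 * Re (u x * cnj (v x))"
      unfolding e_def cmod_power2 by (simp add: power2_eq_square algebra_simps)
    moreover have "Re (q x) - Re (u x * cnj (v x)) \<le> h x * d x"
    proof -
      have "q x - u x * cnj (v x) = cnj (sgn (G x)) * u x * of_real (h x - k x)"
        unfolding q_def vsgn uh[of x, symmetric] by (simp add: algebra_simps)
      then have "Re (q x) - Re (u x * cnj (v x)) \<le> cmod (cnj (sgn (G x)) * u x * of_real (h x - k x))"
        by (metis complex_Re_le_cmod minus_complex.simps(1))
      also have "\<dots> = norm (sgn (G x)) * (h x * d x)"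
        by (simp only: norm_mult cu d_def norm_of_real complex_mod_cnj mult.assoc)
      also have "\<dots> \<le> 1 * (h x * d x)"
        by (intro mult_right_mono) (auto simp: norm_sgn hk0 d_def)
      finally show ?thesis by simp
    qed
    ultimately show ?thesis by (simp add: cu cv)
  qed
  have iR: "integrable M (\<lambda>x. (h x)\<^sup>2 + (k x)\<^sup>2 - 2 * Re (q x) + 2 * (h x * d x))"
    using ih ik iq ihd by simp
  have ie: "integrable M (\<lambda>x. (e x)\<^sup>2)"
    by (rule Bochner_Integration.integrable_bound[OF iR]) (use ee in \<open>auto intro: order_trans[OF _ abs_ge_self]\<close>)
  have "(\<integral>x. (e x)\<^sup>2 \<partial>M) \<le> (\<integral>x. (h x)\<^sup>2 + (k x)\<^sup>2 - 2 * Re (q x) + 2 * (h x * d x) \<partial>M)"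
    by (rule integral_mono[OF ie iR ee])
  also have "\<dots> = S + (S - \<delta>) - 2 * Re (\<integral>x. q x \<partial>M) + 2 * (\<integral>x. h x * d x \<partial>M)"
    using ih ik iq ihd by (simp add: Sh Sk integral_Re[OF iq])
  also have "\<dots> = \<delta> + 2 * (\<integral>x. h x * d x \<partial>M)"
    using mart by (simp add: q_def S_def \<delta>_def)
  also have "\<dots> \<le> \<delta> + 2 * (sqrt S * sqrt \<delta>)"
    using hd by simp
  finally have E: "(\<integral>x. (e x)\<^sup>2 \<partial>M) \<le> \<delta> + 2 * (sqrt S * sqrt \<delta>)" .
  have ike: "integrable M (\<lambda>x. k x * e x)" by (rule Cauchy_Schwarz_integral(1)[OF _ _ ik ie]) measurable
  have "(\<integral>x. k x * e x \<partial>M) \<le> sqrt (\<integral>x. (k x)\<^sup>2 \<partial>M) * sqrt (\<integral>x. (e x)\<^sup>2 \<partial>M)"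
    by (rule Cauchy_Schwarz_integral(2)[OF _ _ ik ie]) measurable
  also have "\<dots> \<le> sqrt S * sqrt (\<delta> + 2 * (sqrt S * sqrt \<delta>))"
    using E S0 \<delta>0 by (intro mult_mono) (auto simp: Sk)
  finally have ke: "(\<integral>x. k x * e x \<partial>M) \<le> sqrt S * sqrt (\<delta> + 2 * (sqrt S * sqrt \<delta>))" .
  have "(\<integral>x. cmod (F x - G x) \<partial>M) \<le> (\<integral>x. h x * d x + k x * e x \<partial>M)"
  proof (rule integral_mono)
    fix x
    have "F x - G x = u x * of_real (h x - k x) + (u x - v x) * of_real (k x)"
      unfolding uh[of x, symmetric] vk[of x, symmetric] by (simp add: algebra_simps)
    then have "cmod (F x - G x) \<le> cmod (u x * of_real (h x - k x)) + cmod ((u x - v x) * of_real (k x))"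
      by (metis norm_triangle_ineq)
    then show "cmod (F x - G x) \<le> h x * d x + k x * e x"
      by (simp only: norm_mult cu d_def e_def norm_of_real abs_of_nonneg[OF hk0(2)] mult.commute)
  qed (use F G ihd ike in auto)
  also have "\<dots> = (\<integral>x. h x * d x \<partial>M) + (\<integral>x. k x * e x \<partial>M)"
    using ihd ike by simp
  finally show "(\<integral>x. cmod (F x - G x) \<partial>M) \<le> sqrt S * sqrt \<delta> + sqrt S * sqrt (\<delta> + 2 * (sqrt S * sqrt \<delta>))"
    using hd ke by linarith
qed

section \<open>The martingale of sections\<close>

lemma measurable_torus_restrict:
  "J \<subseteq> I \<Longrightarrow> (\<lambda>z. restrict z J) \<in> torus I \<rightarrow>\<^sub>M torus J"
  unfolding torus_def by (rule measurable_restrict_subset)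

lemma distr_torus_restrict:
  assumes "finite J" "J \<subseteq> I"
  shows "distr (torus I) (torus J) (\<lambda>z. restrict z J) = torus J"
proof -
  interpret product_prob_space "\<lambda>_. circle_haar" I
    by unfold_locales
  show ?thesis unfolding torus_def by (rule distr_PiM_restrict_finite[OF assms])
qed

lemma
  fixes f :: "(nat \<Rightarrow> complex) \<Rightarrow> 'b::{banach, second_countable_topology}"
  assumes J: "finite J" "J \<subseteq> I"
  shows integrable_torus_restrict: "integrable (torus J) f \<Longrightarrow> integrable (torus I) (\<lambda>z. f (restrict z J))"
    and integral_torus_restrict: "f \<in> borel_measurable (torus J) \<Longrightarrow>
      (\<integral>z. f (restrict z J) \<partial>torus I) = (\<integral>z. f z \<partial>torus J)"
  using integrable_distr[OF measurable_torus_restrict[OF J(2)], of f]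
    integral_distr[OF measurable_torus_restrict[OF J(2)], of f]
  by (simp_all add: distr_torus_restrict[OF J])

lemma slice_mean_mult_cylinder:
  fixes f \<phi> :: "(nat \<Rightarrow> complex) \<Rightarrow> 'b::{real_normed_field, banach, second_countable_topology}"
  assumes "m \<le> n"
  shows "slice_mean n (\<lambda>z. f z * \<phi> (restrict z {..<m})) z = slice_mean n f z * \<phi> (restrict z {..<m})"
proof -
  have "restrict (z(n := w)) {..<m} = restrict z {..<m}" for w
    using assms by (auto simp: restrict_def fun_eq_iff)
  then show ?thesis by (simp add: slice_mean_def)
qed

lemma measurable_cylinder:
  assumes "m \<le> n" "\<phi> \<in> borel_measurable (torus {..<m})"
  shows "(\<lambda>z. \<phi> (restrict z {..<m})) \<in> borel_measurable (torus {..<n})"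
  by (rule measurable_compose[OF measurable_torus_restrict assms(2)]) (use assms(1) in auto)

lemma restrict_space_torus: "z \<in> space (torus J) \<Longrightarrow> restrict z J = z"
  by (simp add: space_torus PiE_restrict)

text \<open>The martingale \<open>g\<close> with submartingale \<open>sqrt \<bar>g\<bar>\<close>, in the form of inequalities between consecutive members. Test functions are
functions of the first \<open>m\<close> coordinates, composed with restriction.\<close>

context
  fixes g :: "nat \<Rightarrow> (nat \<Rightarrow> complex) \<Rightarrow> complex"
  assumes integrable_g: "\<And>n. n \<ge> 1 \<Longrightarrow> integrable (torus {..<n}) (g n)"
    and slice_mean_g: "\<And>n. n \<ge> 1 \<Longrightarrow> AE z in torus {..<n}. slice_mean n (g (Suc n)) z = g n z"
    and sqrt_submean_g: "\<And>n. n \<ge> 1 \<Longrightarrow>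
      AE z in torus {..<n}. sqrt (cmod (g n z)) \<le> slice_mean n (\<lambda>z. sqrt (cmod (g (Suc n) z))) z"
begin

text \<open>Averaging over a coordinate beyond the first \<open>m\<close> leaves the test function alone.\<close>

lemma martingale_integral:
  assumes m: "1 \<le> m" "m \<le> n" and \<phi>: "\<phi> \<in> borel_measurable (torus {..<m})"
    and bound: "\<And>z. cmod (\<phi> z) \<le> 1"
  shows "(\<integral>z. g n z * \<phi> (restrict z {..<m}) \<partial>torus {..<n}) =
    (\<integral>z. g m z * \<phi> (restrict z {..<m}) \<partial>torus {..<m})"
  using m(2)
proof (induction n rule: dec_induct)
  case (step n)
  have n: "1 \<le> n" "1 \<le> Suc n" "m \<le> n" "m \<le> Suc n" using m step by auto
  note meas = measurable_cylinder[OF n(3) \<phi>]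
  have int: "integrable (torus {..<Suc n}) (\<lambda>z. g (Suc n) z * \<phi> (restrict z {..<m}))"
    by (rule integrable_mult_bounded[OF integrable_g[OF n(2)] measurable_cylinder[OF n(4) \<phi>]]) (rule bound)
  have "(\<integral>z. g (Suc n) z * \<phi> (restrict z {..<m}) \<partial>torus {..<Suc n}) =
    (\<integral>z. slice_mean n (g (Suc n)) z * \<phi> (restrict z {..<m}) \<partial>torus {..<n})"
    by (simp add: integral_slice_mean[OF int, symmetric] slice_mean_mult_cylinder[OF n(3)])
  also have "\<dots> = (\<integral>z. g n z * \<phi> (restrict z {..<m}) \<partial>torus {..<n})"
  proof (rule integral_cong_AE)
    show "AE z in torus {..<n}. slice_mean n (g (Suc n)) z * \<phi> (restrict z {..<m}) = g n z * \<phi> (restrict z {..<m})"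
      using slice_mean_g[OF n(1)] by eventually_elim simp
  qed (intro borel_measurable_times meas borel_measurable_integrable integrable_slice_mean integrable_g n)+
  finally show ?case by (rule trans[OF _ step.IH])
qed simp

text \<open>The test function has to be square integrable rather than bounded, since it will be \<open>sqrt \<bar>g m\<bar>\<close>.\<close>

lemma submartingale_integral:
  assumes m: "1 \<le> m" "m \<le> n" and \<psi>: "\<psi> \<in> borel_measurable (torus {..<m})"
    and nonneg: "\<And>z. 0 \<le> \<psi> z" and square: "integrable (torus {..<m}) (\<lambda>z. (\<psi> z)\<^sup>2)"
  shows "(\<integral>z. sqrt (cmod (g m z)) * \<psi> (restrict z {..<m}) \<partial>torus {..<m}) \<le>
    (\<integral>z. sqrt (cmod (g n z)) * \<psi> (restrict z {..<m}) \<partial>torus {..<n})"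
  using m(2)
proof (induction n rule: dec_induct)
  case (step n)
  have n: "1 \<le> n" "1 \<le> Suc n" "m \<le> n" "m \<le> Suc n" using m step by auto
  have int: "integrable (torus {..<k}) (\<lambda>z. sqrt (cmod (g k z)) * \<psi> (restrict z {..<m}))"
    if k: "1 \<le> k" "m \<le> k" for k
  proof (rule integrable_mult_square)
    show "(\<lambda>z. sqrt (cmod (g k z))) \<in> borel_measurable (torus {..<k})"
      using borel_measurable_integrable[OF integrable_g[OF k(1)]] by measurable
    show "(\<lambda>z. \<psi> (restrict z {..<m})) \<in> borel_measurable (torus {..<k})"
      by (rule measurable_cylinder[OF k(2) \<psi>])
    show "integrable (torus {..<k}) (\<lambda>z. (sqrt (cmod (g k z)))\<^sup>2)"
      using integrable_g[OF k(1)] by simp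
    show "integrable (torus {..<k}) (\<lambda>z. (\<psi> (restrict z {..<m}))\<^sup>2)"
      using k by (intro integrable_torus_restrict square) auto
  qed
  note int' = int[OF n(2,4)]
  have "(\<integral>z. sqrt (cmod (g n z)) * \<psi> (restrict z {..<m}) \<partial>torus {..<n}) \<le>
    (\<integral>z. slice_mean n (\<lambda>z. sqrt (cmod (g (Suc n) z)) * \<psi> (restrict z {..<m})) z \<partial>torus {..<n})"
  proof (rule integral_mono_AE)
    show "AE z in torus {..<n}. sqrt (cmod (g n z)) * \<psi> (restrict z {..<m}) \<le>
        slice_mean n (\<lambda>z. sqrt (cmod (g (Suc n) z)) * \<psi> (restrict z {..<m})) z"
      using sqrt_submean_g[OF n(1)]
      by eventually_elim (simp only: slice_mean_mult_cylinder[OF n(3),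
          of "\<lambda>z. sqrt (cmod (g (Suc n) z))" \<psi>] mult_right_mono nonneg)
  qed (rule int[OF n(1,3)] integrable_slice_mean[OF int'])+
  also have "\<dots> = (\<integral>z. sqrt (cmod (g (Suc n) z)) * \<psi> (restrict z {..<m}) \<partial>torus {..<Suc n})"
    by (rule integral_slice_mean[OF int'])
  finally show ?case by (rule order_trans[OF step.IH])
qed simp

text \<open>The test functions \<open>sqrt \<bar>g m\<bar>\<close> and \<open>cnj (sgn (g m))\<close> give the two hypotheses of
\<open>L1_distance_via_square_roots\<close> on the common space \<open>\<T>\<^sup>\<infinity>\<close>.\<close>

lemma cylinder_L1_distance:
  fixes m n :: nat
  assumes m: "1 \<le> m" "m \<le> n"
  defines "G \<equiv> \<lambda>k z. g k (restrict z {..<k})"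
  defines "S \<equiv> \<lambda>k. \<integral>z. cmod (G k z) \<partial>torus UNIV"
  shows "S m \<le> S n"
    and "(\<integral>z. cmod (G n z - G m z) \<partial>torus UNIV) \<le>
      sqrt (S n) * sqrt (S n - S m) + sqrt (S n) * sqrt (S n - S m + 2 * (sqrt (S n) * sqrt (S n - S m)))"
proof -
  have n: "1 \<le> n" using m by simp
  have intG: "integrable (torus UNIV) (G k)" if "1 \<le> k" for k
    unfolding G_def by (intro integrable_torus_restrict integrable_g that) auto
  note [measurable] = borel_measurable_integrable[OF integrable_g[OF m(1)]]
    borel_measurable_integrable[OF integrable_g[OF n]]
  have rr: "restrict z {..<m} = restrict (restrict z {..<n}) {..<m}" for z :: "nat \<Rightarrow> complex"
    using m(2) by (auto simp: restrict_def fun_eq_iff)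
  have sub: "(\<integral>z. cmod (G m z) \<partial>torus UNIV) \<le> (\<integral>z. sqrt (cmod (G n z)) * sqrt (cmod (G m z)) \<partial>torus UNIV)"
  proof -
    let ?\<psi> = "\<lambda>z. sqrt (cmod (g m z))"
    have meas: "(\<lambda>z. sqrt (cmod (g n z)) * ?\<psi> (restrict z {..<m})) \<in> borel_measurable (torus {..<n})"
      by (intro borel_measurable_times measurable_cylinder[OF m(2)]) measurable
    have "(\<integral>z. cmod (G m z) \<partial>torus UNIV) = (\<integral>z. cmod (g m z) \<partial>torus {..<m})"
      unfolding G_def by (rule integral_torus_restrict) auto
    also have "\<dots> = (\<integral>z. sqrt (cmod (g m z)) * ?\<psi> (restrict z {..<m}) \<partial>torus {..<m})"
      by (rule Bochner_Integration.integral_cong) (simp_all add: restrict_space_torus)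
    also have "\<dots> \<le> (\<integral>z. sqrt (cmod (g n z)) * ?\<psi> (restrict z {..<m}) \<partial>torus {..<n})"
      by (rule submartingale_integral[OF m]) (use integrable_g[OF m(1)] in auto)
    also have "\<dots> = (\<integral>z. sqrt (cmod (G n z)) * sqrt (cmod (G m z)) \<partial>torus UNIV)"
      using integral_torus_restrict[OF _ _ meas, of UNIV] by (simp only: G_def finite_lessThan subset_UNIV simp_thms flip: rr)
    finally show ?thesis .
  qed
  have mart: "(\<integral>z. G n z * cnj (sgn (G m z)) \<partial>torus UNIV) = of_real (\<integral>z. cmod (G m z) \<partial>torus UNIV)"
  proof -
    let ?\<phi> = "\<lambda>z. cnj (sgn (g m z))"
    have "(\<lambda>x. sgn (g m x)) \<in> borel_measurable (torus {..<m})" unfolding sgn_div_norm by measurable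
    then have \<phi>: "?\<phi> \<in> borel_measurable (torus {..<m})"
      by (rule borel_measurable_continuous_on[rotated]) (intro continuous_intros)
    have meas: "(\<lambda>z. g n z * ?\<phi> (restrict z {..<m})) \<in> borel_measurable (torus {..<n})"
      by (intro borel_measurable_times measurable_cylinder[OF m(2) \<phi>]) measurable
    have "(\<integral>z. G n z * cnj (sgn (G m z)) \<partial>torus UNIV) = (\<integral>z. g n z * ?\<phi> (restrict z {..<m}) \<partial>torus {..<n})"
      using integral_torus_restrict[OF _ _ meas, of UNIV] by (simp only: G_def finite_lessThan subset_UNIV simp_thms flip: rr)
    also have "\<dots> = (\<integral>z. g m z * ?\<phi> (restrict z {..<m}) \<partial>torus {..<m})"
    proof (rule martingale_integral[OF m \<phi>])
      show "cmod (?\<phi> z) \<le> 1" for z by (simp only: complex_mod_cnj norm_sgn) simp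
    qed
    also have "\<dots> = (\<integral>z. of_real (cmod (g m z)) \<partial>torus {..<m})"
    proof (rule Bochner_Integration.integral_cong)
      fix z assume "z \<in> space (torus {..<m})"
      then have "restrict z {..<m} = z" by (rule restrict_space_torus)
      moreover have "w * cnj (sgn w) = of_real (cmod w)" for w :: complex
      proof (cases "w = 0")
        case False
        then show ?thesis
          by (simp add: sgn_eq divide_eq_eq power2_eq_square flip: complex_norm_square)
      qed simp
      ultimately show "g m z * ?\<phi> (restrict z {..<m}) = of_real (cmod (g m z))" by simp
    qed simp
    also have "\<dots> = of_real (\<integral>z. cmod (g m z) \<partial>torus {..<m})" by simp
    also have "(\<integral>z. cmod (g m z) \<partial>torus {..<m}) = (\<integral>z. cmod (G m z) \<partial>torus UNIV)"
      unfolding G_def by (rule integral_torus_restrict[symmetric]) auto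
    finally show ?thesis .
  qed
  note est = L1_distance_via_square_roots[OF intG[OF n] intG[OF m(1)] sub mart]
  from est(1) show "S m \<le> S n" by (simp add: S_def)
  from est(2) show "(\<integral>z. cmod (G n z - G m z) \<partial>torus UNIV) \<le>
      sqrt (S n) * sqrt (S n - S m) + sqrt (S n) * sqrt (S n - S m + 2 * (sqrt (S n) * sqrt (S n - S m)))"
    by (simp add: S_def)
qed

text \<open>The norms increase and are bounded, so they form a Cauchy sequence; by \<open>cylinder_L1_distance\<close> the
functions then do so in \<open>L\<^sup>1\<close>. The index is shifted because \<open>g 0\<close> is not controlled.\<close>

theorem cylinder_L1_limit:
  assumes bound: "\<And>n. n \<ge> 1 \<Longrightarrow> (\<integral>z. cmod (g n z) \<partial>torus {..<n}) \<le> C"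
  obtains f where "integrable (torus UNIV) f"
    "(\<lambda>n. \<integral>z. cmod (g (Suc n) (restrict z {..<Suc n}) - f z) \<partial>torus UNIV) \<longlonglongrightarrow> 0"
proof -
  define G where "G = (\<lambda>k z. g k (restrict z {..<k}))"
  define S where "S = (\<lambda>k. \<integral>z. cmod (G k z) \<partial>torus UNIV)"
  define \<omega> where "\<omega> \<delta> = sqrt C * sqrt \<delta> + sqrt C * sqrt (\<delta> + 2 * (sqrt C * sqrt \<delta>))" for \<delta>
  have intG: "integrable (torus UNIV) (G k)" if "1 \<le> k" for k
    unfolding G_def by (intro integrable_torus_restrict integrable_g that) auto
  have SC: "S k \<le> C" if "1 \<le> k" for k
  proof -
    note [measurable] = borel_measurable_integrable[OF integrable_g[OF that]]
    have "S k = (\<integral>z. cmod (g k z) \<partial>torus {..<k})"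
      unfolding S_def G_def by (rule integral_torus_restrict) auto
    then show ?thesis using bound[OF that] by simp
  qed
  have S0: "0 \<le> S k" for k by (simp add: S_def)
  have mono: "S m \<le> S n" if "1 \<le> m" "m \<le> n" for m n
    using cylinder_L1_distance(1)[OF that] by (simp add: S_def G_def)
  have dist: "(\<integral>z. cmod (G n z - G m z) \<partial>torus UNIV) \<le> \<omega> (S n - S m)" if "1 \<le> m" "m \<le> n" for m n
  proof -
    let ?\<delta> = "S n - S m"
    have le: "sqrt (S n) \<le> sqrt C" using SC[of n] that by simp
    have \<delta>: "0 \<le> ?\<delta>" using mono[OF that] by simp
    have C0: "0 \<le> C" using S0[of n] SC[of n] that by simp
    have "(\<integral>z. cmod (G n z - G m z) \<partial>torus UNIV) \<le>
        sqrt (S n) * sqrt ?\<delta> + sqrt (S n) * sqrt (?\<delta> + 2 * (sqrt (S n) * sqrt ?\<delta>))"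
      using cylinder_L1_distance(2)[OF that] by (simp add: S_def G_def)
    also have "\<dots> \<le> \<omega> ?\<delta>"
      unfolding \<omega>_def using le \<delta> S0[of n] C0
      by (intro add_mono mult_mono real_sqrt_le_mono mult_left_mono mult_right_mono) auto
    finally show ?thesis .
  qed
  have "incseq (\<lambda>n. S (Suc n))" by (rule incseq_SucI) (simp add: mono)
  then have "convergent (\<lambda>n. S (Suc n))"
    using SC by (intro Bseq_mono_convergent BseqI'[of _ C] ) (auto simp: S0 incseq_def)
  then have cauchyS: "Cauchy (\<lambda>n. S (Suc n))" by (rule convergent_Cauchy)
  have "\<exists>N. \<forall>i\<ge>N. \<forall>j\<ge>N. (\<integral>z. cmod (G (Suc i) z - G (Suc j) z) \<partial>torus UNIV) < e" if e: "e > 0" for e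
  proof -
    have "isCont \<omega> 0" unfolding \<omega>_def by (intro continuous_intros)
    then have "\<omega> \<midarrow>0\<rightarrow> 0" by (simp add: isCont_def \<omega>_def)
    from LIM_D[OF this e] obtain d where d: "d > 0"
      "\<And>x. x \<noteq> 0 \<Longrightarrow> norm (x - 0) < d \<Longrightarrow> norm (\<omega> x - 0) < e" by blast
    have small: "\<omega> x < e" if "\<bar>x\<bar> < d" for x
      using d(2)[of x] that e by (cases "x = 0") (auto simp: \<omega>_def)
    obtain N where N: "\<And>i j. i \<ge> N \<Longrightarrow> j \<ge> N \<Longrightarrow> \<bar>S (Suc i) - S (Suc j)\<bar> < d"
      using CauchyD[OF cauchyS d(1)] by auto
    have ordered: "(\<integral>z. cmod (G (Suc i) z - G (Suc j) z) \<partial>torus UNIV) < e" if "j \<le> i" "i \<ge> N" "j \<ge> N" for i j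
      using dist[of "Suc j" "Suc i"] small[OF N[OF that(2,3)]] that(1) by simp
    have "(\<integral>z. cmod (G (Suc i) z - G (Suc j) z) \<partial>torus UNIV) < e" if "i \<ge> N" "j \<ge> N" for i j
    proof (cases "j \<le> i")
      case False
      then show ?thesis using ordered[of i j] that by (simp add: norm_minus_commute)
    qed (use ordered that in auto)
    then show ?thesis by blast
  qed
  moreover have "integrable (torus UNIV) (G (Suc n))" for n by (rule intG) simp
  ultimately obtain f where "integrable (torus UNIV) f"
      "(\<lambda>n. \<integral>z. cmod (G (Suc n) z - f z) \<partial>torus UNIV) \<longlonglongrightarrow> 0"
    using L1_complete[of "torus UNIV" "\<lambda>n. G (Suc n)"] by blast
  then show ?thesis using that by (simp add: G_def)
qed

end

lemma fourier_coeff_restrict: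
  assumes f: "integrable (torus {..<n}) f" and \<nu>: "\<nu> \<in> freqs {..<n}"
  shows "fourier_coeff UNIV (\<lambda>z. f (restrict z {..<n})) \<nu> = fourier_coeff {..<n} f \<nu>"
proof -
  have "monomial \<nu> (restrict z {..<n}) = monomial \<nu> z" for z
    unfolding monomial_def using freqsD[OF \<nu>] by (intro prod.cong) auto
  moreover have "(\<integral>z. f (restrict z {..<n}) * cnj (monomial \<nu> (restrict z {..<n})) \<partial>torus UNIV) =
    (\<integral>z. f z * cnj (monomial \<nu> z) \<partial>torus {..<n})"
    by (rule integral_torus_restrict)
       (use integrable_fourier[OF f \<nu>] in auto)
  ultimately show ?thesis by (simp add: fourier_coeff_def)
qed

lemma fourier_coeff_tendsto:
  assumes s: "\<And>n. integrable (torus I) (s n)" and f: "integrable (torus I) f" and \<nu>: "\<nu> \<in> freqs I"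
    and lim: "(\<lambda>n. \<integral>z. cmod (s n z - f z) \<partial>torus I) \<longlonglongrightarrow> 0"
  shows "(\<lambda>n. fourier_coeff I (s n) \<nu>) \<longlonglongrightarrow> fourier_coeff I f \<nu>"
  unfolding fourier_coeff_def
proof (rule tendsto_integral_L1)
  have "(\<integral>z. cmod (s n z * cnj (monomial \<nu> z) - f z * cnj (monomial \<nu> z)) \<partial>torus I) = (\<integral>z. cmod (s n z - f z) \<partial>torus I)" for n
    by (rule Bochner_Integration.integral_cong)
       (simp_all add: norm_mult cmod_monomial[OF \<nu>] flip: left_diff_distrib)
  with lim show "(\<lambda>n. \<integral>z. cmod (s n z * cnj (monomial \<nu> z) - f z * cnj (monomial \<nu> z)) \<partial>torus I) \<longlonglongrightarrow> 0"
    by simp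
qed (intro integrable_fourier s f \<nu>)+

theorem corollary3:
  fixes a :: "(nat \<Rightarrow> int) \<Rightarrow> complex" and C :: real
  assumes "\<And>\<nu>. \<nu> \<in> freqs UNIV - nonneg_freqs UNIV \<Longrightarrow> a \<nu> = 0"
    and "\<And>m. m \<ge> 1 \<Longrightarrow>
           \<exists>g \<in> H1 {..<m}. is_fourier_series_of {..<m} (abschnitt m a) g \<and> H1_norm {..<m} g \<le> C"
  shows "\<exists>f \<in> H1 UNIV. (\<forall>\<nu> \<in> nonneg_freqs UNIV. fourier_coeff UNIV f \<nu> = a \<nu>) \<and>
           H1_norm UNIV f \<le> C"
proof -
  have "\<forall>m. \<exists>g. m \<ge> 1 \<longrightarrow> g \<in> H1 {..<m} \<and> is_fourier_series_of {..<m} (abschnitt m a) g \<and> H1_norm {..<m} g \<le> C"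
    using assms(2) by blast
  from choice[OF this] obtain g where g: "\<And>m. m \<ge> 1 \<Longrightarrow> g m \<in> H1 {..<m}"
    "\<And>m. m \<ge> 1 \<Longrightarrow> is_fourier_series_of {..<m} (abschnitt m a) (g m)"
    "\<And>m. m \<ge> 1 \<Longrightarrow> H1_norm {..<m} (g m) \<le> C" by blast
  have int: "integrable (torus {..<m}) (g m)" if "m \<ge> 1" for m
    using g(1)[OF that] by (simp add: H1_def)
  have coeff: "fourier_coeff {..<m} (g m) \<nu> = a \<nu>" if "m \<ge> 1" "\<nu> \<in> freqs {..<m}" for m \<nu>
    using g(2)[OF that(1)] that(2) by (simp add: is_fourier_series_of_def abschnitt_def)
  have mean: "AE z in torus {..<n}. slice_mean n (g (Suc n)) z = g n z" if n: "n \<ge> 1" for n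
  proof (rule fourier_coeff_unique)
    show "integrable (torus {..<n}) (slice_mean n (g (Suc n)))" by (rule integrable_slice_mean[OF int]) simp
    show "integrable (torus {..<n}) (g n)" by (rule int[OF n])
    fix \<nu> assume \<nu>: "\<nu> \<in> freqs {..<n}"
    then have "\<nu> \<in> freqs {..<Suc n}" using freqs_mono[of "{..<n}" "{..<Suc n}"] by auto
    then show "fourier_coeff {..<n} (slice_mean n (g (Suc n))) \<nu> = fourier_coeff {..<n} (g n) \<nu>"
      using fourier_coeff_slice_mean[OF int \<nu>] coeff n \<nu> by simp
  qed
  have sub: "AE z in torus {..<n}. sqrt (cmod (g n z)) \<le> slice_mean n (\<lambda>z. sqrt (cmod (g (Suc n) z))) z"
    if n: "n \<ge> 1" for n
  proof -
    have "g (Suc n) \<in> H1 {..<Suc n}" by (rule g(1)) simp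
    from sqrt_submean_slice[OF this] mean[OF n] show ?thesis by eventually_elim simp
  qed
  have bound: "(\<integral>z. cmod (g n z) \<partial>torus {..<n}) \<le> C" if "n \<ge> 1" for n
    using g(3)[OF that] by (simp add: H1_norm_def)
  define s where "s n z = g (Suc n) (restrict z {..<Suc n})" for n z
  obtain f where f: "integrable (torus UNIV) f" "(\<lambda>n. \<integral>z. cmod (s n z - f z) \<partial>torus UNIV) \<longlonglongrightarrow> 0"
    using cylinder_L1_limit[OF int mean sub bound] unfolding s_def by blast
  have ints: "integrable (torus UNIV) (s n)" for n
    unfolding s_def by (intro integrable_torus_restrict int) auto
  have coeff_f: "fourier_coeff UNIV f \<nu> = a \<nu>" if \<nu>: "\<nu> \<in> freqs UNIV" for \<nu>
  proof (rule LIMSEQ_unique[OF fourier_coeff_tendsto[OF ints f(1) \<nu> f(2)]])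
    obtain k where k: "{n. \<nu> n \<noteq> 0} \<subseteq> {..<k}"
      using freqs_finite[OF \<nu>] finite_nat_iff_bounded by auto
    have "\<forall>\<^sub>F n in sequentially. a \<nu> = fourier_coeff UNIV (s n) \<nu>"
      using eventually_ge_at_top[of k]
    proof eventually_elim
      case (elim n)
      then have "\<nu> \<in> freqs {..<Suc n}"
        using k freqs_finite[OF \<nu>] unfolding freqs_def by auto
      then show ?case
        unfolding s_def by (simp add: fourier_coeff_restrict[OF int] coeff)
    qed
    then show "(\<lambda>n. fourier_coeff UNIV (s n) \<nu>) \<longlonglongrightarrow> a \<nu>"
      by (rule Lim_transform_eventually[OF tendsto_const])
  qed
  have "f \<in> H1 UNIV"
    using f(1) coeff_f assms(1) by (simp add: H1_def)
  moreover have "\<forall>\<nu> \<in> nonneg_freqs UNIV. fourier_coeff UNIV f \<nu> = a \<nu>"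
    using coeff_f by (simp add: nonneg_freqs_def)
  moreover have "H1_norm UNIV f \<le> C"
  proof -
    have "(\<integral>z. cmod (f z) \<partial>torus UNIV) \<le> (\<integral>z. cmod (s n z - f z) \<partial>torus UNIV) + C" for n
    proof -
      note [measurable] = borel_measurable_integrable[OF int[of "Suc n"]]
      have "(\<integral>z. cmod (s n z) \<partial>torus UNIV) = (\<integral>z. cmod (g (Suc n) z) \<partial>torus {..<Suc n})"
        unfolding s_def by (rule integral_torus_restrict) auto
      then have "(\<integral>z. cmod (s n z) \<partial>torus UNIV) \<le> C" using bound[of "Suc n"] by simp
      moreover have "(\<integral>z. cmod (f z - 0) \<partial>torus UNIV) \<le>
          (\<integral>z. cmod (f z - s n z) \<partial>torus UNIV) + (\<integral>z. cmod (s n z - 0) \<partial>torus UNIV)"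
        by (rule L1_triangle[OF f(1) ints]) simp
      ultimately show ?thesis by (simp add: norm_minus_commute)
    qed
    moreover have "(\<lambda>n. (\<integral>z. cmod (s n z - f z) \<partial>torus UNIV) + C) \<longlonglongrightarrow> 0 + C"
      by (intro tendsto_add f(2) tendsto_const)
    ultimately have "(\<integral>z. cmod (f z) \<partial>torus UNIV) \<le> 0 + C"
      by (intro LIMSEQ_le_const) auto
    then show ?thesis by (simp add: H1_norm_def)
  qed
  ultimately show ?thesis by blast
qed

end
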